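(* Let $s, t \geq 2$ be integers. Every $\mathcal{J}_{s,t}$-minor-free graph $G$ is isomorphic to a subgraph of $H \boxtimes P \boxtimes K_m$ for some path $P$ and some graph $H$ with $\mathrm{tw}(H) \leq s$, where $m := (t-1)\,\mathrm{ltw}(G)$.
   Context: All graphs are finite, simple and undirected. $\mathrm{tw}$ denotes treewidth. $\mathcal{J}_{s,t}$ is the class of graphs whose vertex-set has a partition $A \cup B$ with $|A| = s$, $|B| = t$, $A$ a clique, every vertex of $A$ adjacent to every vertex of $B$, and $G[B]$ connected; $\mathcal{J}_{s,t}$-minor-free means containing no graph of $\mathcal{J}_{s,t}$ as a minor. A layering of $G$ is a partition $(V_1, V_2, \dots)$ of $V(G)$ such that for each edge $vw$ with $v \in V_i$, $w \in V_j$ we have $|i-j| \leq 1$. The layered treewidth $\mathrm{ltw}(G)$ is the minimum integer $k$ such that $G$ has a layering $\mathcal{L}$ and a tree-decomposition $(T,\mathcal{W})$ with $|L \cap W| \leq k$ for every layer $L$ and every bag $W$. The strong product $A \boxtimes B$ has vertex-set $V(A)\times V(B)$, where distinct $(v,x),(w,y)$ are adjacent if ($v=w$ and $xy\in E(B)$), or ($x=y$ and $vw\in E(A)$), or ($vw\in E(A)$ and $xy\in E(B)$). $K_m$ is the complete graph on $m$ vertices. *)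

theory Defs
  imports Main
begin

record 'a ugraph =
  verts :: "'a set"
  edges :: "'a set set"

definition simple_graph :: "'a ugraph \<Rightarrow> bool" where
  "simple_graph G \<longleftrightarrow>
     finite (verts G) \<and> (\<forall>e\<in>edges G. e \<subseteq> verts G \<and> card e = 2)"

definition adj :: "'a ugraph \<Rightarrow> 'a \<Rightarrow> 'a \<Rightarrow> bool" where
  "adj G u v \<longleftrightarrow> {u, v} \<in> edges G"

definition subgraph :: "'a ugraph \<Rightarrow> 'a ugraph \<Rightarrow> bool" where
  "subgraph S G \<longleftrightarrow> simple_graph S \<and> verts S \<subseteq> verts G \<and> edges S \<subseteq> edges G"

definition induced :: "'a ugraph \<Rightarrow> 'a set \<Rightarrow> 'a ugraph" where
  "induced G X = \<lparr>verts = verts G \<inter> X, edges = {e \<in> edges G. e \<subseteq> X}\<rparr>"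

definition isomorphic :: "'a ugraph \<Rightarrow> 'b ugraph \<Rightarrow> bool" where
  "isomorphic G H \<longleftrightarrow>
     (\<exists>f. bij_betw f (verts G) (verts H) \<and>
          (\<forall>u\<in>verts G. \<forall>v\<in>verts G. adj G u v \<longleftrightarrow> adj H (f u) (f v)))"

text \<open>Connected graphs are nonempty by convention.\<close>

definition connected_graph :: "'a ugraph \<Rightarrow> bool" where
  "connected_graph G \<longleftrightarrow>
     verts G \<noteq> {} \<and> (\<forall>u\<in>verts G. \<forall>v\<in>verts G. (adj G)\<^sup>*\<^sup>* u v)"

definition is_cycle :: "'a ugraph \<Rightarrow> 'a list \<Rightarrow> bool" where
  "is_cycle G vs \<longleftrightarrow>
     length vs \<ge> 3 \<and> distinct vs \<and> set vs \<subseteq> verts G \<and>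
     (\<forall>i. Suc i < length vs \<longrightarrow> adj G (vs ! i) (vs ! Suc i)) \<and>
     adj G (last vs) (hd vs)"

definition is_tree :: "'a ugraph \<Rightarrow> bool" where
  "is_tree T \<longleftrightarrow> simple_graph T \<and> connected_graph T \<and> (\<nexists>vs. is_cycle T vs)"

definition complete_graph :: "nat \<Rightarrow> nat ugraph" where
  "complete_graph m =
     \<lparr>verts = {..<m}, edges = {{i, j} | i j. i < m \<and> j < m \<and> i \<noteq> j}\<rparr>"

definition path_graph :: "nat \<Rightarrow> nat ugraph" where
  "path_graph n = \<lparr>verts = {..<n}, edges = {{i, Suc i} | i. Suc i < n}\<rparr>"

definition strong_product :: "'a ugraph \<Rightarrow> 'b ugraph \<Rightarrow> ('a \<times> 'b) ugraph"
    (infixl \<open>\<boxtimes>\<close> 70) where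
  "A \<boxtimes> B =
     \<lparr>verts = verts A \<times> verts B,
      edges = {{(v, x), (w, y)} | v x w y.
        v \<in> verts A \<and> w \<in> verts A \<and> x \<in> verts B \<and> y \<in> verts B \<and>
        (v, x) \<noteq> (w, y) \<and>
        (v = w \<and> adj B x y \<or> x = y \<and> adj A v w \<or> adj A v w \<and> adj B x y)}\<rparr>"

text \<open>A minor is given by a model: disjoint connected branch sets in \<open>G\<close>, one for
  each vertex of \<open>H\<close>, with an edge of \<open>G\<close> between the branch sets of adjacent vertices.\<close>

definition minor_of :: "'b ugraph \<Rightarrow> 'a ugraph \<Rightarrow> bool" where
  "minor_of H G \<longleftrightarrow>
     (\<exists>\<mu> :: 'b \<Rightarrow> 'a set.
        (\<forall>x\<in>verts H. \<mu> x \<subseteq> verts G \<and> connected_graph (induced G (\<mu> x))) \<and>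
        (\<forall>x\<in>verts H. \<forall>y\<in>verts H. x \<noteq> y \<longrightarrow> \<mu> x \<inter> \<mu> y = {}) \<and>
        (\<forall>x\<in>verts H. \<forall>y\<in>verts H. adj H x y \<longrightarrow> (\<exists>u\<in>\<mu> x. \<exists>v\<in>\<mu> y. adj G u v)))"

definition J_class :: "nat \<Rightarrow> nat \<Rightarrow> 'a ugraph set" where
  "J_class s t =
     {G. simple_graph G \<and>
         (\<exists>A B. A \<union> B = verts G \<and> A \<inter> B = {} \<and> card A = s \<and> card B = t \<and>
            (\<forall>u\<in>A. \<forall>v\<in>A. u \<noteq> v \<longrightarrow> adj G u v) \<and>
            (\<forall>u\<in>A. \<forall>v\<in>B. adj G u v) \<and>
            connected_graph (induced G B))}"

text \<open>Below, vertices of forbidden minors and nodes of decomposition trees are natural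
  numbers; every finite graph has an isomorphic copy of this kind.\<close>

definition J_minor_free :: "nat \<Rightarrow> nat \<Rightarrow> 'a ugraph \<Rightarrow> bool" where
  "J_minor_free s t G \<longleftrightarrow> \<not> (\<exists>J :: nat ugraph. J \<in> J_class s t \<and> minor_of J G)"

definition tree_decomposition :: "'a ugraph \<Rightarrow> nat ugraph \<Rightarrow> (nat \<Rightarrow> 'a set) \<Rightarrow> bool" where
  "tree_decomposition G T W \<longleftrightarrow>
     is_tree T \<and>
     (\<forall>x\<in>verts T. W x \<subseteq> verts G) \<and>
     (\<forall>e\<in>edges G. \<exists>x\<in>verts T. e \<subseteq> W x) \<and>
     (\<forall>v\<in>verts G. connected_graph (induced T {x \<in> verts T. v \<in> W x}))"

text \<open>The value is an integer because the graph without vertices has treewidth \<open>-1\<close>.\<close>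

definition treewidth :: "'a ugraph \<Rightarrow> int" where
  "treewidth G =
     int (LEAST k. \<exists>T W. tree_decomposition G T W \<and> (\<forall>x\<in>verts T. card (W x) \<le> k)) - 1"

text \<open>Layers may be empty, so a finite layering is one that is eventually empty.\<close>

definition layering :: "'a ugraph \<Rightarrow> (nat \<Rightarrow> 'a set) \<Rightarrow> bool" where
  "layering G L \<longleftrightarrow>
     (\<Union>i. L i) = verts G \<and>
     (\<forall>i j. i \<noteq> j \<longrightarrow> L i \<inter> L j = {}) \<and>
     (\<forall>v w i j. adj G v w \<and> v \<in> L i \<and> w \<in> L j \<longrightarrow> \<bar>int i - int j\<bar> \<le> 1)"

definition layered_treewidth :: "'a ugraph \<Rightarrow> nat" where
  "layered_treewidth G =
     (LEAST k. \<exists>L T W. layering G L \<and> tree_decomposition G T W \<and>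
        (\<forall>i. \<forall>x\<in>verts T. card (L i \<inter> W x) \<le> k))"

text \<open>The minima defining \<^const>\<open>treewidth\<close> and \<^const>\<open>layered_treewidth\<close> are attained.\<close>

lemma tree_decomposition_single_bag:
  assumes "simple_graph G"
  shows "tree_decomposition G (complete_graph 1) (\<lambda>_. verts G)"
proof -
  have "distinct vs \<Longrightarrow> set vs \<subseteq> {0::nat} \<Longrightarrow> length vs \<le> 1" for vs
    using card_mono[of "{0::nat}" "set vs"] by (simp add: distinct_card)
  then have "\<not> is_cycle (complete_graph 1) vs" for vs
    by (force simp: is_cycle_def complete_graph_def)
  moreover have "{..<Suc 0} = {0}" by auto
  ultimately show ?thesis using assms
    by (auto simp: tree_decomposition_def is_tree_def simple_graph_def connected_graph_def
        induced_def complete_graph_def)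
qed

lemma treewidth_attained:
  assumes "simple_graph G"
  shows "\<exists>T W. tree_decomposition G T W \<and> (\<forall>x\<in>verts T. int (card (W x)) \<le> treewidth G + 1)"
proof -
  have "\<exists>k. \<exists>T W. tree_decomposition G T W \<and> (\<forall>x\<in>verts T. card (W x) \<le> k)"
    using tree_decomposition_single_bag[OF assms] by blast
  from LeastI_ex[OF this] show ?thesis
    unfolding treewidth_def by simp
qed

lemma layered_treewidth_attained:
  assumes "simple_graph G"
  shows "\<exists>L T W. layering G L \<and> tree_decomposition G T W \<and>
           (\<forall>i. \<forall>x\<in>verts T. card (L i \<inter> W x) \<le> layered_treewidth G)"
proof -
  have "layering G (\<lambda>i. if i = 0 then verts G else {})"
    by (auto simp: layering_def split: if_splits)
  moreover have "card ((if i = 0 then verts G else {}) \<inter> verts G) \<le> card (verts G)" for i :: nat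
    by simp
  ultimately have "\<exists>k. \<exists>L T W. layering G L \<and> tree_decomposition G T W \<and>
      (\<forall>i. \<forall>x\<in>verts T. card (L i \<inter> W x) \<le> k)"
    using tree_decomposition_single_bag[OF assms] by blast
  from LeastI_ex[OF this] show ?thesis
    unfolding layered_treewidth_def .
qed

end

theory Submission imports Defs begin

text \<open>
  Fix a tree-decomposition of \<open>G\<close> attaining the layered treewidth. It suffices to partition \<open>V(G)\<close>
  into parts, each covered by \<open>t - 1\<close> bags, such that the quotient has treewidth at most \<open>s\<close>: a
  part then has at most \<open>(t - 1) ltw(G)\<close> vertices in each layer.

  The parts are chosen one at a time. Each component \<open>C\<close> of the remaining graph is adjacent to at most
  \<open>s\<close> earlier parts, and there are disjoint, connected, pairwise adjacent branch sets \<open>U\<^sub>i\<close> outside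
  \<open>C\<close>, one for each of these parts, that contain the neighbours of \<open>C\<close>. Let \<open>F\<close> be the family of
  connected subsets of \<open>C\<close> adjacent to all \<open>U\<^sub>i\<close>. By the Erdos-Posa property of subtrees,
  either \<open>t - 1\<close> bags meet all members of \<open>F\<close>, or \<open>F\<close> has \<open>t\<close> disjoint members. In the first
  case a minimal hitting set inside these bags is the next part: each component left over misses some
  \<open>U\<^sub>i\<close>, and the new part, joined to \<open>U\<^sub>i\<close>, replaces it. In the second case, if there are \<open>s\<close>
  branch sets, then these and the \<open>t\<close> members, enlarged so as to cover \<open>C\<close>, form a forbidden minor;
  otherwise \<open>C\<close> contains two disjoint members of \<open>F\<close> separated by a subset of one bag, and this
  separator is the next part, with one more branch set on either side.
\<close>

section \<open>Connected sets and components\<close>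

definition linked :: "('a \<Rightarrow> 'a \<Rightarrow> bool) \<Rightarrow> 'a set \<Rightarrow> 'a set \<Rightarrow> bool" where
  "linked E A B \<longleftrightarrow> (\<exists>a\<in>A. \<exists>b\<in>B. E a b)"

text \<open>Phrasing connectedness by cuts avoids reasoning about walks.\<close>

definition conn :: "('a \<Rightarrow> 'a \<Rightarrow> bool) \<Rightarrow> 'a set \<Rightarrow> bool" where
  "conn E S \<longleftrightarrow> S \<noteq> {} \<and> (\<forall>Q. Q \<subseteq> S \<and> Q \<noteq> {} \<and> Q \<noteq> S \<longrightarrow> linked E Q (S - Q))"

definition component :: "('a \<Rightarrow> 'a \<Rightarrow> bool) \<Rightarrow> 'a set \<Rightarrow> 'a set \<Rightarrow> bool" where
  "component E S K \<longleftrightarrow> K \<subseteq> S \<and> conn E K \<and> \<not> linked E K (S - K)"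

lemma linked_mono: "linked E A B \<Longrightarrow> A \<subseteq> A' \<Longrightarrow> B \<subseteq> B' \<Longrightarrow> linked E A' B'"
  unfolding linked_def by blast

lemma linked_sym: "symp E \<Longrightarrow> linked E A B \<Longrightarrow> linked E B A"
  unfolding linked_def by (blast dest: sympD)

lemma conn_nonempty: "conn E S \<Longrightarrow> S \<noteq> {}"
  unfolding conn_def by blast

lemma conn_linked: "conn E S \<Longrightarrow> Q \<subseteq> S \<Longrightarrow> Q \<noteq> {} \<Longrightarrow> Q \<noteq> S \<Longrightarrow> linked E Q (S - Q)"
  unfolding conn_def by blast

text \<open>\<open>Q\<close> may reach outside \<open>S\<close>, so a cut can be given by any
  property of vertices, such as reachability.\<close>

lemma conn_cross:
  assumes "conn E S" "a \<in> S" "a \<in> Q" "b \<in> S" "b \<notin> Q"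
  shows "\<exists>x\<in>S \<inter> Q. \<exists>y\<in>S - Q. E x y"
proof -
  have "linked E (S \<inter> Q) (S - (S \<inter> Q))"
    using assms by (intro conn_linked) auto
  then show ?thesis unfolding linked_def by blast
qed

lemma connI:
  assumes "S \<noteq> {}"
    and "\<And>Q a b. a \<in> Q \<Longrightarrow> Q \<subseteq> S \<Longrightarrow> b \<in> S \<Longrightarrow> b \<notin> Q \<Longrightarrow> \<exists>x\<in>Q. \<exists>y\<in>S - Q. E x y"
  shows "conn E S"
  unfolding conn_def linked_def using assms by blast

lemma conn_singleton: "conn E {a}"
  by (rule connI) auto

text \<open>A cut of \<open>S\<close> separates \<open>a\<close> from some vertex of
  \<open>S\<close>, so it also cuts a connected set \<open>Z\<close> containing both and is crossed
  there.\<close>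

lemma conn_star:
  assumes "a \<in> S" and "\<And>x. x \<in> S \<Longrightarrow> \<exists>Z\<subseteq>S. conn E Z \<and> a \<in> Z \<and> x \<in> Z"
  shows "conn E S"
proof (rule connI)
  fix Q q r assume q: "q \<in> Q" "Q \<subseteq> S" and r: "r \<in> S" "r \<notin> Q"
  have "\<exists>Z\<subseteq>S. conn E Z \<and> (\<exists>u\<in>Z \<inter> Q. \<exists>v\<in>Z. v \<notin> Q)"
  proof (cases "a \<in> Q")
    case True
    then show ?thesis using assms(2)[OF r(1)] r by blast
  next
    case False
    then show ?thesis using assms(2)[of q] q by blast
  qed
  then obtain Z u v where Z: "Z \<subseteq> S" "conn E Z" "u \<in> Z" "u \<in> Q" "v \<in> Z" "v \<notin> Q" by blast
  from conn_cross[OF Z(2-6)] Z(1) show "\<exists>x\<in>Q. \<exists>y\<in>S - Q. E x y" by blast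
qed (use assms in blast)

lemma conn_Un:
  assumes "symp E" "conn E A" "conn E B" "A \<inter> B \<noteq> {} \<or> linked E A B"
  shows "conn E (A \<union> B)"
proof (rule connI)
  fix Q q r assume q: "q \<in> Q" "Q \<subseteq> A \<union> B" and r: "r \<in> A \<union> B" "r \<notin> Q"
  show "\<exists>x\<in>Q. \<exists>y\<in>A \<union> B - Q. E x y"
  proof (cases "(\<exists>a\<in>A. \<exists>b\<in>A. a \<in> Q \<and> b \<notin> Q) \<or> (\<exists>a\<in>B. \<exists>b\<in>B. a \<in> Q \<and> b \<notin> Q)")
    case True
    then obtain D a b where D: "conn E D" "D \<subseteq> A \<union> B" "a \<in> D" "a \<in> Q" "b \<in> D" "b \<notin> Q"
      using assms(2,3) by (metis Un_upper1 Un_upper2)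
    from conn_cross[OF D(1,3-6)] D(2) show ?thesis by blast
  next
    case False
    then have "A \<inter> B = {}" "A \<subseteq> Q \<and> B \<inter> Q = {} \<or> B \<subseteq> Q \<and> A \<inter> Q = {}"
      using q r by blast+
    with assms(4) have "linked E A B" by blast
    moreover from this have "linked E B A" by (rule linked_sym[OF assms(1)])
    ultimately show ?thesis
      using \<open>A \<subseteq> Q \<and> B \<inter> Q = {} \<or> B \<subseteq> Q \<and> A \<inter> Q = {}\<close> unfolding linked_def by blast
  qed
qed (use conn_nonempty[OF assms(2)] in blast)

lemma conn_insert:
  assumes "symp E" "conn E Z" "k \<in> Z" "E k y"
  shows "conn E (insert y Z)"
  using conn_Un[OF assms(1,2) conn_singleton[of E y]] assms(3,4)
  by (auto simp: linked_def)

lemma conn_Un_Union: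
  assumes "symp E" "conn E A" "\<And>S. S \<in> \<S> \<Longrightarrow> conn E S \<and> (A \<inter> S \<noteq> {} \<or> linked E A S)"
  shows "conn E (A \<union> \<Union>\<S>)"
proof -
  obtain a where a: "a \<in> A" using conn_nonempty[OF assms(2)] by blast
  show ?thesis
  proof (rule conn_star[of a])
    fix x assume x: "x \<in> A \<union> \<Union>\<S>"
    show "\<exists>Z\<subseteq>A \<union> \<Union>\<S>. conn E Z \<and> a \<in> Z \<and> x \<in> Z"
    proof (cases "x \<in> A")
      case True
      then show ?thesis using a assms(2) by blast
    next
      case False
      then obtain S where S: "S \<in> \<S>" "x \<in> S" using x by blast
      then have "conn E (A \<union> S)" using assms conn_Un by blast
      then show ?thesis using S a by (intro exI[of _ "A \<union> S"]) auto
    qed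
  qed (use a in blast)
qed

lemma component_exists:
  assumes "symp E" "a \<in> S"
  shows "\<exists>K. component E S K \<and> a \<in> K"
proof -
  \<comment> \<open>The union of all connected subsets of \<open>S\<close> through \<open>a\<close>.
    An edge leaving it inside \<open>S\<close> would enlarge one of them by
    \<open>conn_insert\<close>.\<close>
  let ?K = "\<Union>{Z. Z \<subseteq> S \<and> conn E Z \<and> a \<in> Z}"
  have a: "a \<in> ?K" using assms(2) conn_singleton[of E a] by blast
  have "conn E ?K"
    by (rule conn_star[OF a]) blast
  moreover have "\<not> linked E ?K (S - ?K)"
  proof
    assume "linked E ?K (S - ?K)"
    then obtain k Z y where "Z \<subseteq> S" "conn E Z" "a \<in> Z" "k \<in> Z" "y \<in> S" "y \<notin> ?K" "E k y"
      unfolding linked_def by blast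
    moreover from this have "conn E (insert y Z)" by (intro conn_insert[OF assms(1)])
    ultimately show False by blast
  qed
  moreover have "?K \<subseteq> S" by blast
  ultimately show ?thesis unfolding component_def using a by (intro exI[of _ ?K]) simp
qed

text \<open>Otherwise \<open>Z\<close>, being connected, has an edge from \<open>K\<close> to a
  vertex of \<open>S\<close> outside \<open>K\<close>.\<close>

lemma component_absorbs:
  assumes "component E S K" "conn E Z" "Z \<subseteq> S" "Z \<inter> K \<noteq> {}"
  shows "Z \<subseteq> K"
proof (rule ccontr)
  assume "\<not> Z \<subseteq> K"
  then obtain x y where "x \<in> Z \<inter> K" "y \<in> Z - K" "E x y"
    using assms(4) conn_cross[OF assms(2), of _ K] by blast
  then show False using assms unfolding component_def linked_def by blast
qed

section \<open>Cuts, walks and induced subgraphs\<close>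

lemma conn_iff_rtranclp:
  "conn E S \<longleftrightarrow>
     S \<noteq> {} \<and> (\<forall>u\<in>S. \<forall>v\<in>S. (\<lambda>x y. x \<in> S \<and> y \<in> S \<and> E x y)\<^sup>*\<^sup>* u v)" (is "_ \<longleftrightarrow> ?r")
proof
  let ?R = "\<lambda>x y. x \<in> S \<and> y \<in> S \<and> E x y"
  assume c: "conn E S"
  have "?R\<^sup>*\<^sup>* u v" if uv: "u \<in> S" "v \<in> S" for u v
  proof (rule ccontr)
    assume "\<not> ?R\<^sup>*\<^sup>* u v"
    then obtain x y where "x \<in> S" "?R\<^sup>*\<^sup>* u x" "y \<in> S" "\<not> ?R\<^sup>*\<^sup>* u y" "E x y"
      using conn_cross[OF c uv(1) _ uv(2), of "{x. ?R\<^sup>*\<^sup>* u x}"] by auto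
    then show False by (metis (mono_tags, lifting) rtranclp.rtrancl_into_rtrancl)
  qed
  then show ?r using conn_nonempty[OF c] by blast
next
  let ?R = "\<lambda>x y. x \<in> S \<and> y \<in> S \<and> E x y"
  assume r: ?r
  show "conn E S"
  proof (rule connI)
    fix Q a b assume Q: "a \<in> Q" "Q \<subseteq> S" "b \<in> S" "b \<notin> Q"
    then have "?R\<^sup>*\<^sup>* a b" using r by blast
    then have "b \<in> Q \<or> (\<exists>x\<in>Q. \<exists>y\<in>S - Q. E x y)"
      by (induction rule: rtranclp_induct) (use Q in auto)
    then show "\<exists>x\<in>Q. \<exists>y\<in>S - Q. E x y" using Q by blast
  qed (use r in blast)
qed

lemma symp_adj: "symp (adj G)"
  by (simp add: symp_def adj_def insert_commute)

lemma connected_induced_iff: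
  assumes "X \<subseteq> verts G"
  shows "connected_graph (induced G X) \<longleftrightarrow> conn (adj G) X"
proof -
  have "adj (induced G X) = (\<lambda>x y. x \<in> X \<and> y \<in> X \<and> adj G x y)"
    by (auto simp: adj_def induced_def fun_eq_iff)
  moreover have "verts (induced G X) = X" using assms by (auto simp: induced_def)
  ultimately show ?thesis by (simp add: connected_graph_def conn_iff_rtranclp)
qed

lemma adj_verts: "simple_graph G \<Longrightarrow> adj G u v \<Longrightarrow> u \<in> verts G \<and> v \<in> verts G \<and> u \<noteq> v"
  unfolding simple_graph_def adj_def by fastforce

lemma connected_graph_iff:
  assumes "simple_graph G"
  shows "connected_graph G \<longleftrightarrow> conn (adj G) (verts G)"
proof -
  have "adj G = (\<lambda>x y. x \<in> verts G \<and> y \<in> verts G \<and> adj G x y)"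
    using adj_verts[OF assms] by (auto simp: fun_eq_iff)
  then show ?thesis by (simp add: connected_graph_def conn_iff_rtranclp)
qed

section \<open>Connected sets and tree-decompositions\<close>

text \<open>Explicit paths serve to exhibit a cycle in a tree. The end vertices of distinct paths
  from \<open>y\<close> form a set that no edge inside \<open>Y\<close> leaves.\<close>

lemma conn_distinct_path:
  assumes "conn E Y" "y \<in> Y" "z \<in> Y"
  shows "\<exists>vs. vs \<noteq> [] \<and> distinct vs \<and> set vs \<subseteq> Y \<and> successively E vs \<and> hd vs = y \<and> last vs = z"
    (is "?P z")
proof (rule ccontr)
  assume "\<not> ?P z"
  moreover have "?P y" using assms by (intro exI[of _ "[y]"]) auto
  ultimately obtain a b where ab: "a \<in> Y" "?P a" "b \<in> Y" "\<not> ?P b" "E a b"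
    using conn_cross[OF assms(1,2) _ assms(3), of "{x. ?P x}"] by auto
  then obtain vs where vs: "vs \<noteq> []" "distinct vs" "set vs \<subseteq> Y" "successively E vs"
    "hd vs = y" "last vs = a" by blast
  have "?P b"
  proof (cases "b \<in> set vs")
    case True
    \<comment> \<open>The path already visits \<open>b\<close>, so it is cut off there and stays
      distinct.\<close>
    then obtain xs ys where "vs = (xs @ [b]) @ ys" by (metis append.assoc append_Cons append_Nil split_list)
    with vs show ?thesis
      by (intro exI[of _ "xs @ [b]"]) (auto simp: successively_append_iff hd_append split: if_splits)
  next
    case False
    with vs ab show ?thesis
      by (intro exI[of _ "vs @ [b]"]) (auto simp: successively_append_iff)
  qed
  with ab show False by blast
qed

text \<open>A largest proper connected subset can be enlarged by an adjacent vertex, and by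
  maximality this already yields \<open>X\<close>; that vertex is the one to remove.\<close>

lemma conn_remove_vertex:
  assumes "symp E" "finite X" "conn E X" "\<And>a. X \<noteq> {a}"
  shows "\<exists>v\<in>X. conn E (X - {v})"
proof -
  let ?P = "\<lambda>Y. Y \<subset> X \<and> conn E Y"
  obtain a where a: "a \<in> X" using conn_nonempty[OF assms(3)] by blast
  have "?P {a}" using a assms(4)[of a] conn_singleton[of E a] by auto
  moreover have "\<forall>Y. ?P Y \<longrightarrow> card Y < Suc (card X)"
    using assms(2) by (meson less_Suc_eq psubset_card_mono)
  ultimately obtain Y where Y: "?P Y" "\<And>Z. ?P Z \<Longrightarrow> card Z \<le> card Y"
    using ex_has_greatest_nat[of ?P "{a}" card "Suc (card X)"] by (metis less_imp_le_nat)
  have "linked E Y (X - Y)" using Y(1) assms(3) conn_nonempty by (intro conn_linked) auto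
  then obtain k b where b: "k \<in> Y" "b \<in> X - Y" "E k b" unfolding linked_def by blast
  then have "conn E (insert b Y)" using conn_insert[OF assms(1)] Y(1) by blast
  moreover have "card (insert b Y) > card Y"
    using b Y(1) assms(2) by (metis DiffD2 card_insert_disjoint finite_subset lessI psubset_imp_subset)
  ultimately have "insert b Y = X" using Y b by (metis DiffD1 insert_subset leD psubsetE psubsetI)
  then have "X - {b} = Y" using b by blast
  then show ?thesis using Y(1) b by blast
qed

text \<open>Two neighbours of \<open>l\<close> would be joined by a path avoiding \<open>l\<close>,
  which closes to a cycle through \<open>l\<close>. Hence \<open>l\<close> is a leaf of the subtree
  on \<open>X\<close>.\<close>

lemma tree_neighbour_unique:
  assumes "is_tree T" "X \<subseteq> verts T" "l \<in> X" "conn (adj T) (X - {l})"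
    and "y \<in> X" "z \<in> X" "adj T l y" "adj T l z"
  shows "y = z"
proof (rule ccontr)
  assume "y \<noteq> z"
  have s: "simple_graph T" using assms(1) by (simp add: is_tree_def)
  have "y \<noteq> l" "z \<noteq> l" using adj_verts[OF s] assms by blast+
  then obtain vs where vs: "vs \<noteq> []" "distinct vs" "set vs \<subseteq> X - {l}" "successively (adj T) vs"
    "hd vs = y" "last vs = z"
    using conn_distinct_path[OF assms(4), of y z] assms(5,6) by blast
  have "length vs \<ge> 2" using vs \<open>y \<noteq> z\<close> by (cases vs; cases "tl vs") auto
  have "successively (adj T) (l # vs)"
    using vs assms(7) by (cases vs) auto
  then have "is_cycle T (l # vs)"
    using vs assms(2,3,8) \<open>length vs \<ge> 2\<close> sympD[OF symp_adj, of T l z]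
    unfolding is_cycle_def successively_conv_nth by auto
  then show False using assms(1) by (auto simp: is_tree_def)
qed

text \<open>A family of subtrees has a simplicial member in its intersection graph, with all
  the subtrees meeting it sharing a node; such a member is found by pruning leaves.\<close>

lemma subtrees_simplicial:
  assumes "is_tree T" "finite X" "X \<subseteq> verts T" "conn (adj T) X"
    and "\<A> \<noteq> {}" "\<And>A. A \<in> \<A> \<Longrightarrow> A \<subseteq> X \<and> conn (adj T) A"
  shows "\<exists>A\<in>\<A>. \<exists>x\<in>A. \<forall>B\<in>\<A>. A \<inter> B \<noteq> {} \<longrightarrow> x \<in> B"
  using assms(2-6)
proof (induction X arbitrary: \<A> rule: finite_psubset_induct)
  case (psubset X)
  have sT: "simple_graph T" using assms(1) by (simp add: is_tree_def)
  show ?case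
  proof (cases "\<exists>a. X = {a}")
    case True
    then obtain a where "X = {a}" by blast
    then have "A = {a}" if "A \<in> \<A>" for A
      using psubset.prems(4)[OF that] conn_nonempty by (metis subset_singletonD)
    then show ?thesis using psubset.prems(3) by blast
  next
    case False
    then obtain l where l: "l \<in> X" "conn (adj T) (X - {l})"
      using conn_remove_vertex[OF symp_adj psubset.hyps psubset.prems(2)] by blast
    show ?thesis
    proof (cases "{l} \<in> \<A>")
      case True
      then show ?thesis by blast
    next
      \<comment> \<open>Every member containing the leaf \<open>l\<close> now also contains its only
        neighbour in \<open>X\<close>. Hence removing \<open>l\<close> keeps all members connected
        and preserves which of them intersect.\<close>
      case nl: False
      have uniq: "y = z" if "y \<in> X" "z \<in> X" "adj T l y" "adj T l z" for y z
        using tree_neighbour_unique[OF assms(1) psubset.prems(1) l that] .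
      have nbr: "\<exists>p\<in>A. adj T l p" if "A \<in> \<A>" "l \<in> A" for A
      proof -
        have "conn (adj T) A" using psubset.prems(4)[OF that(1)] by blast
        moreover have "A \<noteq> {l}" using that nl by blast
        ultimately have "linked (adj T) {l} (A - {l})" using that by (intro conn_linked) auto
        then show ?thesis unfolding linked_def by blast
      qed
      have sub: "A - {l} \<subseteq> X - {l} \<and> conn (adj T) (A - {l})" if A: "A \<in> \<A>" for A
      proof -
        have cA: "A \<subseteq> X" "conn (adj T) A" using psubset.prems(4)[OF A] by auto
        have "conn (adj T) (A - {l})"
        proof (cases "l \<in> A")
          case lA: True
          obtain p where p: "p \<in> A" "adj T l p" using nbr[OF A lA] by blast
          show ?thesis
          proof (rule connI)
            show "A - {l} \<noteq> {}" using p adj_verts[OF sT p(2)] by blast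
          next
            fix Q a b assume Q: "a \<in> Q" "Q \<subseteq> A - {l}" "b \<in> A - {l}" "b \<notin> Q"
            \<comment> \<open>The leaf is put on the side of its neighbour \<open>p\<close>, so an
              edge across the extended cut cannot end in \<open>l\<close>.\<close>
            let ?Q = "if p \<in> Q then insert l Q else Q"
            have "a \<in> A" "a \<in> ?Q" "b \<in> A" "b \<notin> ?Q" using Q by auto
            from conn_cross[OF cA(2) this]
            obtain x y where xy: "x \<in> A \<inter> ?Q" "y \<in> A - ?Q" "adj T x y" by blast
            have "x \<noteq> l" using xy Q uniq[of y p] p cA(1) by (auto split: if_splits)
            moreover have "y \<noteq> l"
              using xy Q uniq[of x p] p cA(1) sympD[OF symp_adj, of T x l] by (auto split: if_splits)
            ultimately show "\<exists>x\<in>Q. \<exists>y\<in>A - {l} - Q. adj T x y"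
              using xy by (auto split: if_splits)
          qed
        qed (use cA in simp)
        then show ?thesis using cA by blast
      qed
      have "\<exists>A\<in>(\<lambda>A. A - {l}) ` \<A>. \<exists>x\<in>A. \<forall>B\<in>(\<lambda>A. A - {l}) ` \<A>. A \<inter> B \<noteq> {} \<longrightarrow> x \<in> B"
        using psubset.IH[of "X - {l}" "(\<lambda>A. A - {l}) ` \<A>"] l psubset.prems sub by blast
      then have "\<exists>A\<in>\<A>. \<exists>x\<in>A - {l}. \<forall>B\<in>\<A>. (A - {l}) \<inter> (B - {l}) \<noteq> {} \<longrightarrow> x \<in> B - {l}"
        by (simp only: bex_simps ball_simps)
      then obtain A x where Ax: "A \<in> \<A>" "x \<in> A - {l}"
        "\<And>B. B \<in> \<A> \<Longrightarrow> (A - {l}) \<inter> (B - {l}) \<noteq> {} \<Longrightarrow> x \<in> B - {l}"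
        by blast
      have "x \<in> B" if B: "B \<in> \<A>" "A \<inter> B \<noteq> {}" for B
      proof (cases "l \<in> A \<inter> B")
        case True
        \<comment> \<open>Members that share \<open>l\<close> also share its neighbour, so they
          still meet after the pruning.\<close>
        then obtain p q where "p \<in> A" "adj T l p" "q \<in> B" "adj T l q" using nbr Ax(1) B by blast
        moreover from this have "p = q" using uniq sub Ax(1) B psubset.prems(4) by blast
        moreover have "p \<noteq> l" using adj_verts[OF sT \<open>adj T l p\<close>] by blast
        ultimately show ?thesis using Ax(3)[OF B(1)] by blast
      qed (use Ax(3) B in blast)
      then show ?thesis using Ax by blast
    qed
  qed
qed

lemma tree_decomposition_nodes_conn:
  assumes "tree_decomposition G T W" "v \<in> verts G"
  shows "conn (adj T) {x \<in> verts T. v \<in> W x}"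
proof -
  have "connected_graph (induced T {x \<in> verts T. v \<in> W x})"
    using assms unfolding tree_decomposition_def by blast
  then show ?thesis by (subst (asm) connected_induced_iff) auto
qed

text \<open>The nodes of one vertex form a subtree, and the subtrees of adjacent vertices share a
  node. A union of such subtrees along a connected set is therefore connected.\<close>

lemma tree_decomposition_trace_conn:
  assumes "tree_decomposition G T W" "S \<subseteq> verts G" "conn (adj G) S"
  shows "conn (adj T) {x \<in> verts T. W x \<inter> S \<noteq> {}}"
proof -
  let ?N = "\<lambda>v. {x \<in> verts T. v \<in> W x}"
  have c: "conn (adj T) (?N v)" if "v \<in> verts G" for v
    using tree_decomposition_nodes_conn[OF assms(1) that] .
  have e: "\<exists>x\<in>verts T. u \<in> W x \<and> v \<in> W x" if "adj G u v" for u v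
    using assms(1) that unfolding tree_decomposition_def adj_def by (metis insert_subset)
  show ?thesis
  proof (rule connI)
    obtain v where "v \<in> S" using conn_nonempty[OF assms(3)] by blast
    then show "{x \<in> verts T. W x \<inter> S \<noteq> {}} \<noteq> {}"
      using conn_nonempty[OF c[of v]] assms(2) by blast
  next
    fix Q a b
    assume Q: "a \<in> Q" "Q \<subseteq> {x \<in> verts T. W x \<inter> S \<noteq> {}}" "b \<in> {x \<in> verts T. W x \<inter> S \<noteq> {}}" "b \<notin> Q"
    obtain u v where uv: "u \<in> S" "u \<in> W a" "v \<in> S" "v \<in> W b" using Q by blast
    \<comment> \<open>Some vertex of \<open>S\<close> has nodes on both sides of the cut: otherwise
      an edge of \<open>G\<close> would join a vertex with all its nodes in \<open>Q\<close> to one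
      with none there, although its two ends share a bag.\<close>
    have "\<exists>w\<in>S. \<not> ?N w \<subseteq> Q \<and> ?N w \<inter> Q \<noteq> {}"
    proof (rule ccontr)
      assume n: "\<not> ?thesis"
      have "u \<in> {w. ?N w \<subseteq> Q}" "v \<notin> {w. ?N w \<subseteq> Q}" using uv Q n by blast+
      then obtain y z where yz: "y \<in> S" "?N y \<subseteq> Q" "z \<in> S" "\<not> ?N z \<subseteq> Q" "adj G y z"
        using conn_cross[OF assms(3) uv(1) _ uv(3), of "{w. ?N w \<subseteq> Q}"] by auto
      then show False using e[OF yz(5)] n by blast
    qed
    then obtain w y z where w: "w \<in> S" "y \<in> ?N w" "y \<in> Q" "z \<in> ?N w" "z \<notin> Q" by blast
    then show "\<exists>x\<in>Q. \<exists>y\<in>{x \<in> verts T. W x \<inter> S \<noteq> {}} - Q. adj T x y"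
      using conn_cross[OF c[of w] w(2-5)] assms(2) by blast
  qed
qed

text \<open>Apply \<open>subtrees_simplicial\<close> to the traces of the members of
  \<open>F\<close> in \<open>T\<close>: sets sharing a vertex have traces sharing a node.\<close>

lemma simplicial_connected_set:
  assumes "tree_decomposition G T W" "F \<noteq> {}"
    and F: "\<And>S. S \<in> F \<Longrightarrow> S \<subseteq> verts G \<and> conn (adj G) S"
  shows "\<exists>S\<in>F. \<exists>x\<in>verts T. \<forall>S'\<in>F. S \<inter> S' \<noteq> {} \<longrightarrow> W x \<inter> S' \<noteq> {}"
proof -
  let ?N = "\<lambda>S. {x \<in> verts T. W x \<inter> S \<noteq> {}}"
  have T: "is_tree T" using assms(1) by (simp add: tree_decomposition_def)
  then have "finite (verts T)" "conn (adj T) (verts T)"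
    using connected_graph_iff[of T] by (auto simp: is_tree_def simple_graph_def)
  then have "\<exists>A\<in>?N ` F. \<exists>x\<in>A. \<forall>B\<in>?N ` F. A \<inter> B \<noteq> {} \<longrightarrow> x \<in> B"
    using assms(2) F tree_decomposition_trace_conn[OF assms(1)]
    by (intro subtrees_simplicial[OF T, of "verts T"]) auto
  then have "\<exists>S\<in>F. \<exists>x\<in>?N S. \<forall>S'\<in>F. ?N S \<inter> ?N S' \<noteq> {} \<longrightarrow> x \<in> ?N S'"
    by (simp only: bex_simps ball_simps)
  then obtain S x where "S \<in> F" "x \<in> ?N S"
    and *: "\<forall>S'\<in>F. ?N S \<inter> ?N S' \<noteq> {} \<longrightarrow> x \<in> ?N S'" by (elim bexE)
  then have S: "S \<in> F" "x \<in> verts T" by auto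
  have "W x \<inter> S' \<noteq> {}" if S': "S' \<in> F" "S \<inter> S' \<noteq> {}" for S'
  proof -
    obtain v where v: "v \<in> S" "v \<in> S'" using S' by blast
    then have "{x \<in> verts T. v \<in> W x} \<noteq> {}"
      using conn_nonempty[OF tree_decomposition_nodes_conn[OF assms(1), of v]] F[OF S(1)] by blast
    then show ?thesis using *[rule_format, OF S'(1)] v by blast
  qed
  then show ?thesis using S by blast
qed

text \<open>Induction on \<open>k\<close>. The bag of a simplicial member \<open>S\<close> meets
  every member that meets \<open>S\<close>, so the members missed by this bag are disjoint from
  \<open>S\<close>. A packing of these is extended by \<open>S\<close>, a set of bags hitting them
  by the one new bag.\<close>

lemma connected_sets_Erdos_Posa:
  assumes "tree_decomposition G T W"
    and "\<And>S. S \<in> F \<Longrightarrow> S \<subseteq> verts G \<and> conn (adj G) S"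
  shows "(\<exists>\<mu>. (\<forall>i<Suc k. \<mu> i \<in> F) \<and> (\<forall>i<Suc k. \<forall>j<Suc k. i \<noteq> j \<longrightarrow> \<mu> i \<inter> \<mu> j = {})) \<or>
    (\<exists>Q\<subseteq>verts T. finite Q \<and> card Q \<le> k \<and> (\<forall>S\<in>F. S \<inter> \<Union>(W ` Q) \<noteq> {}))"
    (is "?A k F \<or> ?B k F")
  using assms(2)
proof (induction k arbitrary: F)
  case 0
  show ?case
  proof (cases "F = {}")
    case True
    then have "?B 0 F" by (intro exI[of _ "{}"]) auto
    then show ?thesis ..
  next
    case False
    then obtain S where "S \<in> F" by blast
    then have "?A 0 F" by (intro exI[of _ "\<lambda>_. S"]) auto
    then show ?thesis ..
  qed
next
  case (Suc k)
  show ?case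
  proof (cases "F = {}")
    case True
    then have "?B (Suc k) F" by (intro exI[of _ "{}"]) auto
    then show ?thesis ..
  next
    case False
    then obtain S x where S: "S \<in> F" "x \<in> verts T" "\<And>S'. S' \<in> F \<Longrightarrow> S \<inter> S' \<noteq> {} \<Longrightarrow> W x \<inter> S' \<noteq> {}"
      using simplicial_connected_set[OF assms(1) False Suc.prems] by blast
    define F' where "F' = {S' \<in> F. W x \<inter> S' = {}}"
    have "?A k F' \<or> ?B k F'" by (rule Suc.IH) (use Suc.prems F'_def in simp)
    then show ?thesis
    proof
      assume "?A k F'"
      then obtain \<mu> where \<mu>0: "\<forall>i<Suc k. \<mu> i \<in> F'"
        "\<forall>i<Suc k. \<forall>j<Suc k. i \<noteq> j \<longrightarrow> \<mu> i \<inter> \<mu> j = {}" by (elim exE conjE)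
      note \<mu> = \<mu>0[rule_format]
      have d: "S \<inter> \<mu> i = {}" if "i < Suc k" for i
        using S(3) \<mu>(1)[OF that] unfolding F'_def by blast
      have "?A (Suc k) F"
      proof (intro exI[of _ "\<mu>(Suc k := S)"] conjI allI impI)
        fix i assume "i < Suc (Suc k)"
        then show "(\<mu>(Suc k := S)) i \<in> F" using S(1) \<mu>(1)[of i] unfolding F'_def by auto
      next
        fix i j assume "i < Suc (Suc k)" "j < Suc (Suc k)" "i \<noteq> j"
        then show "(\<mu>(Suc k := S)) i \<inter> (\<mu>(Suc k := S)) j = {}"
          using \<mu>(2)[of i j] d[of i] d[of j] by auto
      qed
      then show ?thesis ..
    next
      assume "?B k F'"
      then obtain Q where Q: "Q \<subseteq> verts T" "finite Q" "card Q \<le> k"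
        and *: "\<forall>S\<in>F'. S \<inter> \<Union>(W ` Q) \<noteq> {}" by (elim exE conjE)
      have "?B (Suc k) F"
      proof (intro exI[of _ "insert x Q"] conjI ballI)
        show "card (insert x Q) \<le> Suc k" using Q(2,3) by (simp add: card_insert_if)
        fix S' assume "S' \<in> F"
        then show "S' \<inter> \<Union>(W ` insert x Q) \<noteq> {}"
          using bspec[OF *, of S'] unfolding F'_def by (cases "W x \<inter> S' = {}") auto
      qed (use S(2) Q in auto)
      then show ?thesis ..
    qed
  qed
qed

section \<open>Separating a region\<close>

text \<open>A model of the complete graph on \<open>R\<close> inside \<open>V\<close>; the indices
  will be the numbers of parts.\<close>

definition clique_model :: "('a \<Rightarrow> 'a \<Rightarrow> bool) \<Rightarrow> 'a set \<Rightarrow> nat set \<Rightarrow> (nat \<Rightarrow> 'a set) \<Rightarrow> bool" where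
  "clique_model E V R U \<longleftrightarrow>
     (\<forall>i\<in>R. conn E (U i) \<and> U i \<subseteq> V) \<and>
     (\<forall>i\<in>R. \<forall>j\<in>R. i \<noteq> j \<longrightarrow> U i \<inter> U j = {} \<and> linked E (U i) (U j))"

text \<open>In passing from a region to its subregion \<open>K\<close>, the branch sets \<open>U i\<close> with \<open>i \<in> R0\<close> are
  kept, those dropped no longer touch \<open>K\<close>, and \<open>Y\<close> is added.\<close>

definition new_branch_set ::
    "('a \<Rightarrow> 'a \<Rightarrow> bool) \<Rightarrow> 'a set \<Rightarrow> nat set \<Rightarrow> (nat \<Rightarrow> 'a set) \<Rightarrow> 'a set \<Rightarrow> nat set \<Rightarrow> 'a set \<Rightarrow> bool" where
  "new_branch_set E V R U K R0 Y \<longleftrightarrow>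
     R0 \<subseteq> R \<and> conn E Y \<and> Y \<subseteq> V - K \<and>
     (\<forall>i\<in>R0. U i \<inter> Y = {} \<and> linked E (U i) Y) \<and> (\<forall>i\<in>R - R0. \<not> linked E (U i) K)"

text \<open>The strict bound \<open>card R0 < s\<close> leaves room for the index of the new part
  \<open>X\<close>, whose branch set \<open>Y\<close> must contain \<open>X\<close>.\<close>

definition splits ::
    "('a \<Rightarrow> 'a \<Rightarrow> bool) \<Rightarrow> 'a set \<Rightarrow> nat \<Rightarrow> nat set \<Rightarrow> (nat \<Rightarrow> 'a set) \<Rightarrow> 'a set \<Rightarrow> 'a set \<Rightarrow> bool" where
  "splits E V s R U C X \<longleftrightarrow>
     (\<forall>K. component E (C - X) K \<longrightarrow>
       (\<exists>R0 Y. card R0 < s \<and> X \<subseteq> Y \<and> new_branch_set E V R U K R0 Y))"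

text \<open>Minimality provides each \<open>x\<close> with a private member of \<open>F\<close>,
  along which \<open>x\<close> can be reached while avoiding the rest of \<open>X\<close>.\<close>

lemma minimal_hitting_set:
  assumes "finite Y" "\<And>S. S \<in> F \<Longrightarrow> S \<inter> Y \<noteq> {}"
  shows "\<exists>X\<subseteq>Y. (\<forall>S\<in>F. S \<inter> X \<noteq> {}) \<and> (\<forall>x\<in>X. \<exists>S\<in>F. S \<inter> X = {x})"
proof -
  let ?P = "\<lambda>X. X \<subseteq> Y \<and> (\<forall>S\<in>F. S \<inter> X \<noteq> {})"
  have "?P Y" using assms(2) by blast
  then obtain X where X: "?P X" "\<And>Z. ?P Z \<Longrightarrow> card X \<le> card Z"
    using ex_has_least_nat[of ?P Y card] by metis
  have "\<exists>S\<in>F. S \<inter> X = {x}" if x: "x \<in> X" for x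
  proof (rule ccontr)
    assume n: "\<not> ?thesis"
    have "S \<inter> (X - {x}) \<noteq> {}" if "S \<in> F" for S
    proof
      assume "S \<inter> (X - {x}) = {}"
      moreover have "S \<inter> X \<noteq> {}" using X(1) that by blast
      ultimately have "S \<inter> X = {x}" by blast
      then show False using n that by blast
    qed
    then have "?P (X - {x})" using X(1) by blast
    from X(2)[OF this] x X(1) assms(1) show False
      by (metis card_Diff1_less finite_subset linorder_not_le)
  qed
  then show ?thesis using X(1) by blast
qed

text \<open>If a component misses the branch set \<open>U i\<close>, then every vertex of a minimal hitting set
  can be joined to \<open>U i\<close> outside that component, so the new part takes over the role of \<open>i\<close>.\<close>

lemma split_by_hitting_set:
  assumes E: "symp E" and C: "C \<subseteq> V" "finite C" "conn E C"
    and R: "finite R" "card R \<le> s" and U: "clique_model E (V - C) R U"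
    and C_linked: "\<And>i. i \<in> R \<Longrightarrow> linked E (U i) C"
    and hit: "\<And>S. S \<subseteq> C \<Longrightarrow> conn E S \<Longrightarrow> \<forall>i\<in>R. linked E (U i) S \<Longrightarrow> S \<inter> B \<noteq> {}"
  shows "\<exists>X. X \<noteq> {} \<and> X \<subseteq> C \<inter> B \<and> splits E V s R U C X"
proof -
  define F where "F = {S. S \<subseteq> C \<and> conn E S \<and> (\<forall>i\<in>R. linked E (U i) S)}"
  have "S \<inter> (C \<inter> B) \<noteq> {}" if "S \<in> F" for S
    using hit[of S] that unfolding F_def by blast
  then obtain X where X: "X \<subseteq> C \<inter> B" "\<And>S. S \<in> F \<Longrightarrow> S \<inter> X \<noteq> {}"
    and min: "\<And>x. x \<in> X \<Longrightarrow> \<exists>S\<in>F. S \<inter> X = {x}"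
    using minimal_hitting_set[of "C \<inter> B" F] C(2) by (metis finite_Int)
  have "C \<in> F" unfolding F_def using C C_linked by blast
  then have "X \<noteq> {}" using X(2) by blast
  moreover have "\<exists>R0 Y. card R0 < s \<and> X \<subseteq> Y \<and> new_branch_set E V R U K R0 Y"
    if K: "component E (C - X) K" for K
  proof -
    have K': "K \<subseteq> C - X" "conn E K" "\<not> linked E K (C - X - K)"
      using K unfolding component_def by auto
    \<comment> \<open>\<open>K\<close> avoids the hitting set and is a connected subset of
      \<open>C\<close>, so it can only fail to be in \<open>F\<close> by missing some
      \<open>U i\<close>.\<close>
    have "K \<notin> F" using X(2)[of K] K' by blast
    then obtain i where i: "i \<in> R" "\<not> linked E (U i) K" unfolding F_def using K' by blast
    \<comment> \<open>All connected pieces of \<open>C - K\<close> that touch \<open>U i\<close>;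
      attached to \<open>U i\<close> they form the new branch set.\<close>
    define \<Z> where "\<Z> = {Z. Z \<subseteq> C - K \<and> conn E Z \<and> linked E (U i) Z}"
    define Y where "Y = U i \<union> \<Union>\<Z>"
    have Ui: "conn E (U i)" "U i \<subseteq> V - C" using U i(1) unfolding clique_model_def by auto
    have Y: "conn E Y" unfolding Y_def
      using conn_Un_Union[OF E Ui(1), of \<Z>] unfolding \<Z>_def by blast
    have "x \<in> \<Union>\<Z>" if x: "x \<in> X" for x
    proof -
      obtain S where S: "S \<subseteq> C" "conn E S" "linked E (U i) S" "S \<inter> X = {x}"
        using min[OF x] i(1) unfolding F_def by blast
      obtain u z where z: "u \<in> U i" "z \<in> S" "E u z" using S(3) unfolding linked_def by blast
      have "z \<notin> K" using i(2) z unfolding linked_def by blast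
      then obtain Q where Q: "component E (S - K) Q" "z \<in> Q"
        using component_exists[OF E, of z "S - K"] z by blast
      have Q': "Q \<subseteq> S - K" "conn E Q" "\<not> linked E Q (S - K - Q)"
        using Q(1) unfolding component_def by auto
      \<comment> \<open>The set \<open>S\<close> leaves \<open>Q\<close> only through
        \<open>K\<close>, and a vertex of \<open>C\<close> outside \<open>K\<close> with a neighbour
        in \<open>K\<close> lies in \<open>X\<close>. Since \<open>S\<close> meets \<open>X\<close>
        only in \<open>x\<close>, the exit from \<open>Q\<close> is \<open>x\<close> itself.\<close>
      have "x \<in> Q"
      proof (rule ccontr)
        assume xQ: "x \<notin> Q"
        have "x \<in> S" using S(4) by blast
        then obtain q y where q: "q \<in> S \<inter> Q" "y \<in> S - Q" "E q y"
          using conn_cross[OF S(2) z(2) Q(2) _ xQ] by blast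
        then have "y \<in> K" using Q'(3) unfolding linked_def by blast
        then have "E y q" "q \<in> C" "q \<notin> K" using q E S(1) Q' by (auto dest: sympD)
        then have "q \<in> X" using K'(3) \<open>y \<in> K\<close> unfolding linked_def by blast
        then have "q \<in> S \<inter> X" using q by blast
        then show False using S(4) q xQ by auto
      qed
      moreover have "Q \<in> \<Z>" unfolding \<Z>_def using Q' S(1) Q(2) z unfolding linked_def by blast
      ultimately show ?thesis by blast
    qed
    then have "X \<subseteq> Y" unfolding Y_def by blast
    moreover have "new_branch_set E V R U K (R - {i}) Y"
      unfolding new_branch_set_def
    proof (intro conjI ballI)
      have "\<Union>\<Z> \<subseteq> C - K" unfolding \<Z>_def by blast
      then show "Y \<subseteq> V - K" using Ui K' C(1) unfolding Y_def by blast
      fix j assume j: "j \<in> R - {i}"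
      then have Uj: "U j \<inter> U i = {}" "linked E (U j) (U i)" "U j \<subseteq> V - C"
        using U i(1) unfolding clique_model_def by auto
      show "U j \<inter> Y = {}" using \<open>\<Union>\<Z> \<subseteq> C - K\<close> Uj unfolding Y_def by blast
      show "linked E (U j) Y" using Uj unfolding Y_def by (meson Un_upper1 linked_mono order_refl)
    next
      fix j assume "j \<in> R - (R - {i})"
      then show "\<not> linked E (U j) K" using i by blast
    qed (use Y in blast)+
    moreover have "card (R - {i}) < s" using R i(1) by (meson card_Diff1_less order_less_le_trans)
    ultimately show ?thesis by blast
  qed
  ultimately show ?thesis using X(1) unfolding splits_def by blast
qed

text \<open>The separator is the boundary between \<open>K1\<close> and the component \<open>D\<close> of \<open>C - K1\<close> that contains
  \<open>S\<close>: seen from either side, the other side supplies the additional branch set.\<close>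

lemma split_between_disjoint_sets:
  assumes E: "symp E" and C: "C \<subseteq> V" "conn E C"
    and R: "card R < s" and U: "clique_model E (V - C) R U"
    and K1: "component E (C - B) K1" "\<And>i. i \<in> R \<Longrightarrow> linked E (U i) K1"
    and S: "S \<subseteq> C" "conn E S" "S \<inter> K1 = {}" "\<And>i. i \<in> R \<Longrightarrow> linked E (U i) S"
  shows "\<exists>X. X \<noteq> {} \<and> X \<subseteq> C \<inter> B \<and> splits E V s R U C X"
proof -
  have K1': "K1 \<subseteq> C - B" "conn E K1" "\<not> linked E K1 (C - B - K1)"
    using K1(1) unfolding component_def by auto
  obtain a where a: "a \<in> S" using conn_nonempty[OF S(2)] by blast
  have "a \<in> C - K1" using a S by blast
  then obtain D where D: "component E (C - K1) D" "a \<in> D"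
    using component_exists[OF E] by blast
  have D': "D \<subseteq> C - K1" "conn E D" "\<not> linked E D (C - K1 - D)"
    using D(1) unfolding component_def by auto
  have "S \<subseteq> D" using component_absorbs[OF D(1) S(2)] S(1,3) a D(2) by blast
  \<comment> \<open>The boundary of \<open>D\<close> towards \<open>K1\<close>. It lies in
    \<open>B\<close> because \<open>K1\<close> is a component of \<open>C - B\<close>, and every
    edge from \<open>D\<close> to the rest of \<open>C\<close> starts in it.\<close>
  define X where "X = {x \<in> D. \<exists>k\<in>K1. E k x}"
  have exit_D: "x \<in> X" if "x \<in> D" "y \<in> C - D" "E x y" for x y
  proof -
    have "y \<in> K1" using D'(3) that unfolding linked_def by blast
    then show ?thesis using that sympD[OF E] unfolding X_def by blast
  qed
  have "X \<subseteq> C \<inter> B"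
  proof
    fix x assume "x \<in> X"
    then have x: "x \<in> C - K1" "\<exists>k\<in>K1. E k x" using D' unfolding X_def by auto
    then show "x \<in> C \<inter> B" using K1'(3) unfolding linked_def by blast
  qed
  moreover have "X \<noteq> {}"
  proof -
    obtain k where k: "k \<in> K1" using conn_nonempty[OF K1'(2)] by blast
    then have "k \<in> C" "k \<notin> D" "a \<in> C" using K1' D' D(2) by auto
    then obtain x y where "x \<in> C \<inter> D" "y \<in> C - D" "E x y"
      using conn_cross[OF C(2) _ D(2)] by blast
    then show ?thesis using exit_D by blast
  qed
  moreover have "\<exists>R0 Y. card R0 < s \<and> X \<subseteq> Y \<and> new_branch_set E V R U K R0 Y"
    if K: "component E (C - X) K" for K
  proof -
    have K': "K \<subseteq> C - X" "conn E K" using K unfolding component_def by auto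
    have Ui: "U i \<inter> C = {}" if "i \<in> R" for i using U that unfolding clique_model_def by blast
    \<comment> \<open>A component outside \<open>D\<close> gets \<open>D\<close> as the new branch
      set, one inside \<open>D\<close> gets \<open>K1\<close> together with \<open>X\<close>. Both
      touch all \<open>U i\<close>, so no index is dropped.\<close>
    have "\<exists>Y. X \<subseteq> Y \<and> conn E Y \<and> Y \<subseteq> C - K \<and> (\<forall>i\<in>R. linked E (U i) Y)"
    proof (cases "K \<inter> D = {}")
      case True
      have "linked E (U i) D" if "i \<in> R" for i
        using S(4)[OF that] \<open>S \<subseteq> D\<close> by (meson linked_mono order_refl)
      then show ?thesis using D' True X_def by (intro exI[of _ D]) auto
    next
      case False
      have "K \<subseteq> D"
      proof (rule ccontr)
        assume "\<not> K \<subseteq> D"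
        then obtain d k where d: "d \<in> K" "d \<in> D" "k \<in> K" "k \<notin> D" using False by blast
        obtain x y where "x \<in> K \<inter> D" "y \<in> K - D" "E x y"
          using conn_cross[OF K'(2) d] by blast
        then show False using exit_D[of x y] K'(1) by blast
      qed
      have "conn E (K1 \<union> \<Union>((\<lambda>x. {x}) ` X))"
      proof (rule conn_Un_Union[OF E K1'(2)])
        fix Z assume "Z \<in> (\<lambda>x. {x}) ` X"
        then show "conn E Z \<and> (K1 \<inter> Z \<noteq> {} \<or> linked E K1 Z)"
          unfolding X_def linked_def by (auto simp: conn_singleton)
      qed
      moreover have "\<Union>((\<lambda>x. {x}) ` X) = X" by blast
      moreover have "linked E (U i) (K1 \<union> X)" if "i \<in> R" for i
        using K1(2)[OF that] by (meson linked_mono order_refl Un_upper1)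
      moreover have "K1 \<union> X \<subseteq> C - K" using K1' D' K' \<open>K \<subseteq> D\<close> unfolding X_def by blast
      ultimately show ?thesis by (intro exI[of _ "K1 \<union> X"]) auto
    qed
    then obtain Y where Y: "X \<subseteq> Y" "conn E Y" "Y \<subseteq> C - K" "\<And>i. i \<in> R \<Longrightarrow> linked E (U i) Y" by blast
    have "new_branch_set E V R U K R Y"
      unfolding new_branch_set_def using Y C(1) Ui by blast
    then show ?thesis using R Y(1) by blast
  qed
  ultimately show ?thesis unfolding splits_def by blast
qed

section \<open>The forbidden minor obtained from a packing\<close>

lemma disjoint_connected_sets_fill:
  fixes \<mu> :: "nat \<Rightarrow> 'a set"
  assumes E: "symp E" and C: "finite C" "conn E C" and t: "t \<ge> 1"
    and \<mu>: "\<And>i. i < t \<Longrightarrow> \<mu> i \<subseteq> C \<and> conn E (\<mu> i)"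
      "\<And>i j. i < t \<Longrightarrow> j < t \<Longrightarrow> i \<noteq> j \<Longrightarrow> \<mu> i \<inter> \<mu> j = {}"
  shows "\<exists>\<nu>. (\<forall>i<t. \<mu> i \<subseteq> \<nu> i \<and> conn E (\<nu> i)) \<and>
    (\<forall>i<t. \<forall>j<t. i \<noteq> j \<longrightarrow> \<nu> i \<inter> \<nu> j = {}) \<and> (\<Union>i<t. \<nu> i) = C"
proof -
  let ?P = "\<lambda>\<nu>. (\<forall>i<t. \<mu> i \<subseteq> \<nu> i \<and> conn E (\<nu> i)) \<and>
    (\<forall>i<t. \<forall>j<t. i \<noteq> j \<longrightarrow> \<nu> i \<inter> \<nu> j = {}) \<and> (\<Union>i<t. \<nu> i) \<subseteq> C"
  let ?c = "\<lambda>\<nu>. card (\<Union>i<t. \<nu> i)"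
  have "?P \<mu>" using \<mu> by blast
  moreover have "\<forall>\<nu>. ?P \<nu> \<longrightarrow> ?c \<nu> < Suc (card C)"
    using C(1) by (simp add: card_mono less_Suc_eq_le)
  \<comment> \<open>An extension covering the most vertices covers \<open>C\<close>: otherwise an
    edge of \<open>C\<close> leaving the union lets one of the sets absorb another vertex.\<close>
  ultimately have "\<exists>\<nu>. ?P \<nu> \<and> (\<forall>\<nu>'. ?P \<nu>' \<longrightarrow> ?c \<nu>' \<le> ?c \<nu>)" by (rule ex_has_greatest_nat)
  then obtain \<nu> where \<nu>: "?P \<nu>" and max: "\<forall>\<nu>'. ?P \<nu>' \<longrightarrow> ?c \<nu>' \<le> ?c \<nu>" by (elim exE conjE) blast
  have "(\<Union>i<t. \<nu> i) = C"
  proof (rule ccontr)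
    assume n: "(\<Union>i<t. \<nu> i) \<noteq> C"
    have "(\<Union>i<t. \<nu> i) \<noteq> {}" using t \<nu> conn_nonempty[of E "\<nu> 0"] by force
    then have "linked E (\<Union>i<t. \<nu> i) (C - (\<Union>i<t. \<nu> i))" using \<nu> n C(2) by (intro conn_linked) auto
    then obtain i a b where i: "i < t" "a \<in> \<nu> i" "b \<in> C" "\<And>j. j < t \<Longrightarrow> b \<notin> \<nu> j" "E a b"
      unfolding linked_def by blast
    let ?\<nu> = "\<nu>(i := insert b (\<nu> i))"
    have "conn E (insert b (\<nu> i))" using conn_insert[OF E _ i(2,5)] \<nu> i(1) by blast
    then have "?P ?\<nu>" using \<nu> i by (auto simp: fun_upd_def)
    then have "?c ?\<nu> \<le> ?c \<nu>" by (rule max[rule_format])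
    moreover have "(\<Union>i<t. ?\<nu> i) = insert b (\<Union>i<t. \<nu> i)" using i(1) by (auto split: if_splits)
    moreover have "finite (\<Union>i<t. \<nu> i)" using \<nu> C(1) by (meson finite_subset)
    moreover have "b \<notin> (\<Union>i<t. \<nu> i)" using i(4) by blast
    ultimately show False by (metis card_insert_disjoint not_less_eq_eq order_refl)
  qed
  then show ?thesis using \<nu> by blast
qed

text \<open>The \<open>U r\<close> are the branch sets of the clique side. The sets
  \<open>\<mu> i\<close> are enlarged until they cover the connected set \<open>C\<close>, which
  makes the other side connected.\<close>

lemma J_minor_of_clique_model:
  assumes G: "simple_graph G" and C: "C \<subseteq> verts G" "conn (adj G) C"
    and R: "finite R" and U: "clique_model (adj G) (verts G - C) R U" and t: "t \<ge> 1"
    and \<mu>: "\<And>i. i < t \<Longrightarrow> \<mu> i \<subseteq> C \<and> conn (adj G) (\<mu> i)"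
      "\<And>i j. i < t \<Longrightarrow> j < t \<Longrightarrow> i \<noteq> j \<Longrightarrow> \<mu> i \<inter> \<mu> j = {}"
      "\<And>i r. i < t \<Longrightarrow> r \<in> R \<Longrightarrow> linked (adj G) (U r) (\<mu> i)"
  shows "\<not> J_minor_free (card R) t G"
proof -
  let ?E = "adj G"
  define s where "s = card R"
  have "finite C" using G C(1) by (auto simp: simple_graph_def intro: finite_subset)
  from disjoint_connected_sets_fill[OF symp_adj this C(2) t, of \<mu>] \<mu>(1,2)
  obtain \<nu> where \<nu>: "\<forall>i<t. \<mu> i \<subseteq> \<nu> i \<and> conn ?E (\<nu> i)"
    "\<forall>i<t. \<forall>j<t. i \<noteq> j \<longrightarrow> \<nu> i \<inter> \<nu> j = {}" "(\<Union>i<t. \<nu> i) = C" by auto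
  obtain h where h: "bij_betw h {..<s} R"
    using ex_bij_betw_nat_finite[OF R] unfolding s_def atLeast0LessThan by blast
  \<comment> \<open>The numbers below \<open>s\<close> stand for the clique side, those from
    \<open>s\<close> to \<open>s + t - 1\<close> for the connected side.\<close>
  define \<beta> where "\<beta> x = (if x < s then U (h x) else \<nu> (x - s))" for x
  \<comment> \<open>\<open>J\<close> takes every edge that the branch sets provide, so it is a minor
    by construction and only its membership in the class is at stake.\<close>
  define J :: "nat ugraph" where
    "J = \<lparr>verts = {..<s + t}, edges = {{x, y} | x y. x < s + t \<and> y < s + t \<and> x \<noteq> y \<and> linked ?E (\<beta> x) (\<beta> y)}\<rparr>"
  have sym: "linked ?E A B \<longleftrightarrow> linked ?E B A" for A B
    using linked_sym[OF symp_adj] by blast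
  have adjJ: "adj J x y \<longleftrightarrow> x < s + t \<and> y < s + t \<and> x \<noteq> y \<and> linked ?E (\<beta> x) (\<beta> y)" for x y
    unfolding J_def adj_def[of "\<lparr>verts = _, edges = _\<rparr>"]
    using sym by (auto simp: doubleton_eq_iff)
  have hR: "h x \<in> R" if "x < s" for x using h that by (auto simp: bij_betw_def)
  have hinj: "h x \<noteq> h y" if "x < s" "y < s" "x \<noteq> y" for x y
    using h that by (auto simp: bij_betw_def inj_on_def)
  have \<nu>C: "\<nu> i \<subseteq> C" if "i < t" for i using \<nu>(3) that by blast
  have \<beta>A: "conn ?E (\<beta> x) \<and> \<beta> x \<subseteq> verts G - C" if "x < s" for x
    using U hR[OF that] that unfolding clique_model_def \<beta>_def by auto
  have \<beta>B: "conn ?E (\<beta> x) \<and> \<beta> x \<subseteq> C" if "\<not> x < s" "x < s + t" for x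
    using \<nu>(1) \<nu>C[of "x - s"] that unfolding \<beta>_def by auto
  have conn: "conn ?E (\<beta> x) \<and> \<beta> x \<subseteq> verts G" if "x < s + t" for x
    using \<beta>A \<beta>B C(1) that by blast
  have disj: "\<beta> x \<inter> \<beta> y = {}" if "x < s + t" "y < s + t" "x \<noteq> y" for x y
  proof (cases "x < s \<longleftrightarrow> y < s")
    case True
    have "x - s \<noteq> y - s" if "\<not> x < s" using True that \<open>x \<noteq> y\<close> by linarith
    then show ?thesis
      using U hR[of x] hR[of y] hinj[of x y] \<nu>(2)[rule_format, of "x - s" "y - s"] that True
      unfolding clique_model_def \<beta>_def by (cases "x < s") auto
  next
    case False
    then show ?thesis using \<beta>A[of x] \<beta>A[of y] \<beta>B[of x] \<beta>B[of y] that by blast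
  qed
  have AA: "adj J x y" if "x < s" "y < s" "x \<noteq> y" for x y
    using U hR[of x] hR[of y] hinj[of x y] that unfolding adjJ clique_model_def \<beta>_def by auto
  have AB: "adj J x y" if "x < s" "y \<in> {s..<s + t}" for x y
  proof -
    have "y - s < t" using that t by (simp add: less_diff_conv2)
    then have "linked ?E (U (h x)) (\<mu> (y - s))" "\<mu> (y - s) \<subseteq> \<nu> (y - s)"
      using \<mu>(3)[of "y - s" "h x"] hR[of x] \<nu>(1)[rule_format, of "y - s"] that by auto
    then have "linked ?E (U (h x)) (\<nu> (y - s))" by (meson linked_mono order_refl)
    then have "linked ?E (\<beta> x) (\<beta> y)" using that unfolding \<beta>_def by auto
    then show ?thesis using that unfolding adjJ by auto
  qed
  have "conn (adj J) {s..<s + t}"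
  proof (rule connI)
    fix Q a b assume Q: "a \<in> Q" "Q \<subseteq> {s..<s + t}" "b \<in> {s..<s + t}" "b \<notin> Q"
    \<comment> \<open>A cut of the connected side pulls back to a cut of \<open>C\<close>; an edge
      of \<open>G\<close> crossing it lies between two branch sets.\<close>
    let ?Q = "\<Union>(\<beta> ` Q)"
    have lt: "x < s + t" "\<not> x < s" if "x \<in> insert b Q" for x using Q that by auto
    obtain u v where u: "u \<in> \<beta> a" and v: "v \<in> \<beta> b"
      using conn_nonempty conn Q by (metis atLeastLessThan_iff equals0I subsetD)
    have "u \<in> C" "v \<in> C" using \<beta>B[of a] \<beta>B[of b] lt[of a] lt[of b] u v Q(1) by auto
    moreover have "v \<notin> ?Q" using disj[of b] lt v Q(4) by blast
    ultimately obtain p q where pq: "p \<in> C \<inter> ?Q" "q \<in> C - ?Q" "?E p q"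
      using conn_cross[OF C(2), of u ?Q v] u Q(1) by blast
    then obtain x where x: "x \<in> Q" "p \<in> \<beta> x" by blast
    obtain i where i: "i < t" "q \<in> \<nu> i" using pq(2) \<nu>(3) by blast
    then have "q \<in> \<beta> (s + i)" unfolding \<beta>_def by simp
    then have "s + i \<notin> Q" "linked ?E (\<beta> x) (\<beta> (s + i))" using pq x unfolding linked_def by blast+
    then have "adj J x (s + i)" unfolding adjJ using lt[of x] x i(1) by auto
    then show "\<exists>x\<in>Q. \<exists>y\<in>{s..<s + t} - Q. adj J x y"
      using x(1) \<open>s + i \<notin> Q\<close> i(1) by (intro bexI[of _ x] bexI[of _ "s + i"]) auto
  qed (use t in auto)
  then have "connected_graph (induced J {s..<s + t})"
    by (subst connected_induced_iff) (auto simp: J_def)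
  moreover have "simple_graph J" unfolding simple_graph_def J_def by (auto simp: card_2_iff)
  ultimately have "J \<in> J_class s t"
    unfolding J_class_def using AA AB
    by (intro CollectI conjI exI[of _ "{..<s}"] exI[of _ "{s..<s + t}"]) (auto simp: J_def)
  moreover have "minor_of J G"
    unfolding minor_of_def
  proof (intro exI[of _ \<beta>] conjI ballI impI)
    fix x assume "x \<in> verts J"
    then have "x < s + t" by (simp add: J_def)
    from conn[OF this] show "\<beta> x \<subseteq> verts G" "connected_graph (induced G (\<beta> x))"
      by (auto simp: connected_induced_iff)
  next
    fix x y assume "x \<in> verts J" "y \<in> verts J" "x \<noteq> y"
    then show "\<beta> x \<inter> \<beta> y = {}" using disj by (simp add: J_def)
  next
    fix x y assume "adj J x y"
    then show "\<exists>u\<in>\<beta> x. \<exists>v\<in>\<beta> y. adj G u v" unfolding adjJ linked_def by blast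
  qed
  ultimately show ?thesis unfolding J_minor_free_def s_def by blast
qed

lemma split_component:
  assumes G: "simple_graph G" and T: "tree_decomposition G T W"
    and J: "J_minor_free s t G" and t: "t \<ge> 2"
    and C: "C \<subseteq> verts G" "conn (adj G) C" and R: "finite R" "card R \<le> s"
    and U: "clique_model (adj G) (verts G - C) R U"
    and C_linked: "\<And>i. i \<in> R \<Longrightarrow> linked (adj G) (U i) C"
  shows "\<exists>X Q. X \<noteq> {} \<and> X \<subseteq> C \<and> Q \<subseteq> verts T \<and> finite Q \<and> card Q \<le> t - 1 \<and> X \<subseteq> \<Union>(W ` Q) \<and>
    splits (adj G) (verts G) s R U C X"
proof -
  let ?E = "adj G"
  have fin: "finite C" using G C(1) by (auto simp: simple_graph_def intro: finite_subset)
  define F where "F = {S. S \<subseteq> C \<and> conn ?E S \<and> (\<forall>i\<in>R. linked ?E (U i) S)}"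
  have F: "S \<subseteq> verts G \<and> conn ?E S" if "S \<in> F" for S using that C(1) unfolding F_def by blast
  have "C \<in> F" unfolding F_def using C C_linked by blast
  \<comment> \<open>With \<open>k = t - 1\<close>, the alternatives are \<open>t\<close> disjoint
    members or \<open>t - 1\<close> bags.\<close>
  have t1: "Suc (t - 1) = t" using t by simp
  have "(\<exists>\<mu>. (\<forall>i<t. \<mu> i \<in> F) \<and> (\<forall>i<t. \<forall>j<t. i \<noteq> j \<longrightarrow> \<mu> i \<inter> \<mu> j = {})) \<or>
    (\<exists>Q\<subseteq>verts T. finite Q \<and> card Q \<le> t - 1 \<and> (\<forall>S\<in>F. S \<inter> \<Union>(W ` Q) \<noteq> {}))"
    using connected_sets_Erdos_Posa[OF T, of F "t - 1", unfolded t1] F by blast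
  then consider (packing) \<mu> where "\<forall>i<t. \<mu> i \<in> F" "\<forall>i<t. \<forall>j<t. i \<noteq> j \<longrightarrow> \<mu> i \<inter> \<mu> j = {}"
    | (hitting) Q where "Q \<subseteq> verts T" "finite Q" "card Q \<le> t - 1" "\<forall>S\<in>F. S \<inter> \<Union>(W ` Q) \<noteq> {}"
    by (elim disjE exE conjE)
  then show ?thesis
  proof cases
    case hitting
    have "S \<inter> \<Union>(W ` Q) \<noteq> {}" if "S \<subseteq> C" "conn ?E S" "\<forall>i\<in>R. linked ?E (U i) S" for S
      using hitting(4) that unfolding F_def by blast
    from split_by_hitting_set[OF symp_adj C(1) fin C(2) R U C_linked this]
    obtain X where "X \<noteq> {}" "X \<subseteq> C \<inter> \<Union>(W ` Q)" "splits ?E (verts G) s R U C X" by blast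
    then show ?thesis using hitting(1-3) by (intro exI[of _ X] exI[of _ Q]) auto
  next
    case packing
    have lt: "card R < s"
    proof (rule ccontr)
      assume "\<not> card R < s"
      then have "card R = s" using R(2) by simp
      moreover have "\<not> J_minor_free (card R) t G"
        by (rule J_minor_of_clique_model[OF G C R(1) U, where \<mu> = \<mu>])
          (use t packing in \<open>auto simp: F_def\<close>)
      ultimately show False using J by simp
    qed
    obtain S x where S: "S \<in> F" "x \<in> verts T" "\<forall>S'\<in>F. S \<inter> S' \<noteq> {} \<longrightarrow> W x \<inter> S' \<noteq> {}"
      using simplicial_connected_set[OF T _ F] \<open>C \<in> F\<close> by (metis empty_iff)
    have Q: "{x} \<subseteq> verts T" "finite {x}" "card {x} \<le> t - 1" using S(2) t by auto
    show ?thesis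
    proof (cases "\<exists>S'\<in>F. W x \<inter> S' = {}")
      case True
      then obtain S' where S': "S' \<in> F" "W x \<inter> S' = {}" by blast
      then have S'': "S' \<subseteq> C - W x" "conn ?E S'" "S' \<noteq> {}" "\<forall>i\<in>R. linked ?E (U i) S'"
        using conn_nonempty unfolding F_def by auto
      \<comment> \<open>\<open>K1\<close> touches every \<open>U i\<close> because \<open>S'\<close>
        does, so it belongs to \<open>F\<close>; missing \<open>W x\<close>, it must be disjoint
        from the simplicial member \<open>S\<close>.\<close>
      then obtain K1 where K1: "component ?E (C - W x) K1" "S' \<inter> K1 \<noteq> {}"
        using component_exists[OF symp_adj] by (metis disjoint_iff ex_in_conv subsetD)
      then have "S' \<subseteq> K1" using component_absorbs[OF K1(1) S''(2,1)] by blast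
      then have l: "linked ?E (U i) K1" if "i \<in> R" for i
        using S''(4) that by (meson linked_mono order_refl)
      have "K1 \<in> F" "W x \<inter> K1 = {}" using K1(1) l unfolding F_def component_def by auto
      then have "S \<inter> K1 = {}" using S(3) by blast
      have SC: "S \<subseteq> C" "conn ?E S" using S(1) unfolding F_def by auto
      have "linked ?E (U i) S" if "i \<in> R" for i using S(1) that unfolding F_def by blast
      from split_between_disjoint_sets[OF symp_adj C lt U K1(1) l SC \<open>S \<inter> K1 = {}\<close> this]
      obtain X where "X \<noteq> {}" "X \<subseteq> C \<inter> W x" "splits ?E (verts G) s R U C X" by blast
      then show ?thesis using Q by (intro exI[of _ X] exI[of _ "{x}"]) auto
    next
      \<comment> \<open>The single bag \<open>W x\<close> meets all of \<open>F\<close>, so the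
        hitting set argument applies to it; \<open>t - 1\<close> is at least 1.\<close>
      case False
      have "S \<inter> W x \<noteq> {}" if "S \<subseteq> C" "conn ?E S" "\<forall>i\<in>R. linked ?E (U i) S" for S
        using False that unfolding F_def by blast
      from split_by_hitting_set[OF symp_adj C(1) fin C(2) R U C_linked this]
      obtain X where "X \<noteq> {}" "X \<subseteq> C \<inter> W x" "splits ?E (verts G) s R U C X" by blast
      then show ?thesis using Q by (intro exI[of _ X] exI[of _ "{x}"]) auto
    qed
  qed
qed

section \<open>Partitions of small treewidth\<close>

text \<open>\<open>R\<close> is a clique in the graph that joins each \<open>b\<close> to the
  earlier vertices in \<open>N b\<close>.\<close>

definition nested_clique :: "(nat \<Rightarrow> nat set) \<Rightarrow> nat set \<Rightarrow> bool" where
  "nested_clique N R \<longleftrightarrow> (\<forall>a\<in>R. \<forall>b\<in>R. a < b \<longrightarrow> a \<in> N b)"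

text \<open>\<open>P\<close> is the set of vertices already placed, \<open>f\<close> assigns to them one of the parts
  \<open>0, \<dots>, n - 1\<close>, and \<open>N j\<close> is the set of earlier neighbours of the part \<open>j\<close> in a chordal
  supergraph of the quotient. A component \<open>C\<close> of the rest is attached to the parts in \<open>R\<close>; the
  branch set \<open>U i\<close> need only contain those vertices of the part \<open>i\<close> that have a neighbour in
  \<open>C\<close>, and it may be far larger than the part.\<close>

definition attached ::
    "'a ugraph \<Rightarrow> nat \<Rightarrow> 'a set \<Rightarrow> ('a \<Rightarrow> nat) \<Rightarrow> nat \<Rightarrow> (nat \<Rightarrow> nat set) \<Rightarrow> 'a set \<Rightarrow> nat set \<Rightarrow>
     (nat \<Rightarrow> 'a set) \<Rightarrow> bool" where
  "attached G s P f n N C R U \<longleftrightarrow>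
     R \<subseteq> {..<n} \<and> card R \<le> s \<and> nested_clique N R \<and> clique_model (adj G) (verts G - C) R U \<and>
     (\<forall>v\<in>C. \<forall>w\<in>P. adj G v w \<longrightarrow> f w \<in> R \<and> w \<in> U (f w))"

text \<open>The conditions on \<open>N\<close> make the reversed order of the parts a perfect
  elimination ordering with at most \<open>s\<close> earlier neighbours each. \<open>D\<close> is
  meant to be the node set of the decomposition tree.\<close>

definition ordered_partition ::
    "'a ugraph \<Rightarrow> 'b set \<Rightarrow> ('b \<Rightarrow> 'a set) \<Rightarrow> nat \<Rightarrow> nat \<Rightarrow> 'a set \<Rightarrow> ('a \<Rightarrow> nat) \<Rightarrow> nat \<Rightarrow>
     (nat \<Rightarrow> nat set) \<Rightarrow> bool" where
  "ordered_partition G D W s q P f n N \<longleftrightarrow>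
     P \<subseteq> verts G \<and> f ` P \<subseteq> {..<n} \<and>
     (\<forall>j<n. N j \<subseteq> {..<j} \<and> card (N j) \<le> s \<and> nested_clique N (N j)) \<and>
     (\<forall>u\<in>P. \<forall>v\<in>P. adj G u v \<longrightarrow> f u = f v \<or> f u \<in> N (f v) \<or> f v \<in> N (f u)) \<and>
     (\<forall>j<n. \<exists>Q\<subseteq>D. finite Q \<and> card Q \<le> q \<and> {v\<in>P. f v = j} \<subseteq> \<Union>(W ` Q))"

text \<open>A part with a vertex adjacent to \<open>C\<close> has a branch set linked to
  \<open>C\<close>, so discarding the unlinked indices loses no neighbour.
  \<open>split_component\<close> needs all branch sets linked.\<close>

lemma attached_restrict:
  assumes "attached G s P f n N C R U" "finite R"
  defines "R' \<equiv> {i \<in> R. linked (adj G) (U i) C}"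
  shows "attached G s P f n N C R' U"
proof -
  have "R' \<subseteq> R" unfolding R'_def by blast
  then have "card R' \<le> card R" using assms(2) by (rule card_mono[rotated])
  moreover have "f w \<in> R'" if "v \<in> C" "w \<in> P" "adj G v w" for v w
    using assms(1) that sympD[OF symp_adj that(3)] unfolding attached_def R'_def linked_def by blast
  moreover have "nested_clique N R'"
    using assms(1) \<open>R' \<subseteq> R\<close> unfolding attached_def nested_clique_def by blast
  moreover have "clique_model (adj G) (verts G - C) R' U"
    using assms(1) \<open>R' \<subseteq> R\<close> unfolding attached_def clique_model_def by blast
  ultimately show ?thesis using assms(1) \<open>R' \<subseteq> R\<close> unfolding attached_def by auto
qed

text \<open>A neighbour of \<open>K\<close> in \<open>P\<close> lies in a branch set that touches
  \<open>K\<close>, hence in one that was kept; a neighbour in \<open>X\<close> lies in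
  \<open>Y\<close>. The new index extends the clique because \<open>R0\<close> is contained in
  \<open>R\<close>, its set of earlier neighbours.\<close>

lemma attached_new_part:
  assumes att: "attached G s P f n N C R U"
    and K: "K \<subseteq> C - X"
    and Y: "X \<subseteq> Y" "card R0 < s" "new_branch_set (adj G) (verts G) R U K R0 Y"
  shows "attached G s (P \<union> X) (\<lambda>v. if v \<in> X then n else f v) (Suc n) (N(n := R)) K
           (insert n R0) (U(n := Y))"
proof -
  let ?E = "adj G"
  have R0: "R0 \<subseteq> R" "R \<subseteq> {..<n}" using att Y(3) unfolding attached_def new_branch_set_def by auto
  then have nR: "n \<notin> R0" "n \<notin> R" by auto
  have "finite R0" using R0 by (meson finite_lessThan finite_subset)
  then have "card (insert n R0) \<le> s" using nR Y(2) by simp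
  moreover have "nested_clique (N(n := R)) (insert n R0)"
  proof -
    have "a \<in> N b" if "a \<in> R0" "b \<in> R0" "a < b" for a b
      using att that R0(1) unfolding attached_def nested_clique_def by blast
    then show ?thesis using R0 nR unfolding nested_clique_def by auto
  qed
  moreover have "clique_model ?E (verts G - K) (insert n R0) (U(n := Y))"
  proof -
    have U: "clique_model ?E (verts G - C) R U" using att unfolding attached_def by blast
    have "conn ?E (U i) \<and> U i \<subseteq> verts G - K" if "i \<in> R0" for i
      using U R0(1) that K unfolding clique_model_def by blast
    moreover have "U i \<inter> U j = {} \<and> linked ?E (U i) (U j)" if "i \<in> R0" "j \<in> R0" "i \<noteq> j" for i j
      using U R0(1) that unfolding clique_model_def by blast
    moreover have "U i \<inter> Y = {} \<and> Y \<inter> U i = {} \<and> linked ?E (U i) Y \<and> linked ?E Y (U i)" if "i \<in> R0" for i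
      using Y(3) that linked_sym[OF symp_adj] unfolding new_branch_set_def by blast
    moreover have "conn ?E Y" "Y \<subseteq> verts G - K" using Y(3) unfolding new_branch_set_def by auto
    ultimately show ?thesis using nR(1) unfolding clique_model_def by auto
  qed
  moreover have "(if w \<in> X then n else f w) \<in> insert n R0 \<and> w \<in> (U(n := Y)) (if w \<in> X then n else f w)"
    if v: "v \<in> K" and w: "w \<in> P \<union> X" and e: "adj G v w" for v w
  proof (cases "w \<in> X")
    case True
    then show ?thesis using Y(1) by auto
  next
    case False
    then have f: "f w \<in> R" "w \<in> U (f w)" using att v w e K unfolding attached_def by auto
    then have "linked ?E (U (f w)) K" using v sympD[OF symp_adj e] unfolding linked_def by blast
    then have "f w \<in> R0" using f(1) Y(3) unfolding new_branch_set_def by blast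
    then show ?thesis using False f nR by auto
  qed
  ultimately show ?thesis using R0 unfolding attached_def by auto
qed

text \<open>The new part \<open>X\<close> gets \<open>R\<close> as its earlier neighbours, which
  accounts for all edges from \<open>C\<close> to \<open>P\<close>. Components avoiding
  \<open>C\<close> were components before and keep their branch sets; those inside \<open>C\<close>
  are handled by \<open>splits\<close>.\<close>

lemma ordered_partition_extend:
  assumes G: "simple_graph G" and T: "tree_decomposition G T W"
    and J: "J_minor_free s t G" and t: "t \<ge> 2"
    and part: "ordered_partition G (verts T) W s (t - 1) P f n N"
    and att: "\<And>C. component (adj G) (verts G - P) C \<Longrightarrow> \<exists>R U. attached G s P f n N C R U"
    and P: "P \<noteq> verts G"
  shows "\<exists>P' f' n' N'. P \<subset> P' \<and> ordered_partition G (verts T) W s (t - 1) P' f' n' N' \<and>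
    (\<forall>C. component (adj G) (verts G - P') C \<longrightarrow> (\<exists>R U. attached G s P' f' n' N' C R U))"
proof -
  let ?E = "adj G"
  have PG: "P \<subseteq> verts G" using part unfolding ordered_partition_def by blast
  then obtain a where "a \<in> verts G - P" using P by blast
  from component_exists[OF symp_adj this] obtain C where C: "component ?E (verts G - P) C" by blast
  have C': "C \<subseteq> verts G" "C \<inter> P = {}" "conn ?E C" "\<not> linked ?E C (verts G - P - C)"
    using C unfolding component_def by auto
  obtain R1 U where R1: "attached G s P f n N C R1 U" using att[OF C] by blast
  define R where "R = {i \<in> R1. linked ?E (U i) C}"
  have "finite R1" using R1 unfolding attached_def by (meson finite_lessThan finite_subset)
  then have R: "attached G s P f n N C R U" "finite R"
    using attached_restrict[OF R1] unfolding R_def by auto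
  have R': "R \<subseteq> {..<n}" "card R \<le> s" "nested_clique N R" "clique_model ?E (verts G - C) R U"
    and RP: "\<And>v w. v \<in> C \<Longrightarrow> w \<in> P \<Longrightarrow> adj G v w \<Longrightarrow> f w \<in> R"
    using R(1) unfolding attached_def by auto
  have "linked ?E (U i) C" if "i \<in> R" for i using that unfolding R_def by blast
  from split_component[OF G T J t C'(1,3) R(2) R'(2,4) this]
  obtain X Q where X: "X \<noteq> {}" "X \<subseteq> C" and Q: "Q \<subseteq> verts T" "finite Q" "card Q \<le> t - 1" "X \<subseteq> \<Union>(W ` Q)"
    and K: "splits ?E (verts G) s R U C X" by blast
  define f' where "f' = (\<lambda>v. if v \<in> X then n else f v)"
  have f'X: "f' v = n" if "v \<in> X" for v using that unfolding f'_def by simp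
  have f'P: "f' v = f v" "f v < n" if "v \<in> P" for v
    using that C'(2) X(2) part unfolding f'_def ordered_partition_def by auto
  let ?N = "N(n := R)"
  have N: "N j \<subseteq> {..<j} \<and> card (N j) \<le> s \<and> nested_clique N (N j)" if "j < n" for j
    using part that unfolding ordered_partition_def by blast
  \<comment> \<open>Changing \<open>N\<close> at \<open>n\<close> does not affect cliques among the
    old parts.\<close>
  have nc: "nested_clique ?N Z" if "nested_clique N Z" "Z \<subseteq> {..<n}" for Z
    using that unfolding nested_clique_def by auto
  have "ordered_partition G (verts T) W s (t - 1) (P \<union> X) f' (Suc n) ?N"
    unfolding ordered_partition_def
  proof (intro conjI allI impI ballI)
    show "P \<union> X \<subseteq> verts G" using PG X(2) C'(1) by blast
    show "f' ` (P \<union> X) \<subseteq> {..<Suc n}" using f'X f'P less_SucI by fastforce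
  next
    fix j assume "j < Suc n"
    then consider "j = n" | "j < n" by linarith
    note cases = this
    show "?N j \<subseteq> {..<j}" using cases N R'(1) by cases auto
    show "card (?N j) \<le> s" using cases N R'(2) by cases auto
    show "nested_clique ?N (?N j)"
      using cases
    proof cases
      case 1
      then show ?thesis using nc[OF R'(3,1)] by simp
    next
      case 2
      then have "N j \<subseteq> {..<n}" using N[OF 2] by auto
      then show ?thesis using nc N[OF 2] 2 by auto
    qed
    show "\<exists>Q\<subseteq>verts T. finite Q \<and> card Q \<le> t - 1 \<and> {v \<in> P \<union> X. f' v = j} \<subseteq> \<Union>(W ` Q)"
      using cases
    proof cases
      case 1
      have "{v \<in> P \<union> X. f' v = j} \<subseteq> X" using f'P 1 by fastforce
      then show ?thesis using Q by (intro exI[of _ Q]) blast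
    next
      case 2
      have "{v \<in> P \<union> X. f' v = j} = {v \<in> P. f v = j}" using f'P f'X 2 by force
      then show ?thesis using part 2 unfolding ordered_partition_def by simp
    qed
  next
    fix u v assume uv: "u \<in> P \<union> X" "v \<in> P \<union> X" "adj G u v"
    have vu: "adj G v u" using sympD[OF symp_adj uv(3)] .
    consider "u \<in> X" "v \<in> X" | "u \<in> X" "v \<in> P" | "u \<in> P" "v \<in> X" | "u \<in> P" "v \<in> P" using uv by blast
    then show "f' u = f' v \<or> f' u \<in> ?N (f' v) \<or> f' v \<in> ?N (f' u)"
    proof cases
      case 1
      then show ?thesis using f'X by simp
    next
      case 2
      then show ?thesis using RP[OF _ _ uv(3)] f'X f'P X(2) by auto
    next
      case 3
      then show ?thesis using RP[OF _ _ vu] f'X f'P X(2) by auto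
    next
      case 4
      then have "f u = f v \<or> f u \<in> N (f v) \<or> f v \<in> N (f u)"
        using part uv(3) unfolding ordered_partition_def by blast
      then show ?thesis using f'P[OF 4(1)] f'P[OF 4(2)] by auto
    qed
  qed
  moreover have "\<exists>R U. attached G s (P \<union> X) f' (Suc n) ?N D R U"
    if D: "component ?E (verts G - (P \<union> X)) D" for D
  proof (cases "D \<inter> C = {}")
    case True
    have D': "D \<subseteq> verts G - (P \<union> X)" "conn ?E D" "\<not> linked ?E D (verts G - (P \<union> X) - D)"
      using D unfolding component_def by auto
    have noC: "\<not> adj G d c" if "d \<in> D" "c \<in> C" for d c
    proof
      assume "adj G d c"
      then have "adj G c d" by (rule sympD[OF symp_adj])
      moreover have "d \<in> verts G - P - C" using D'(1) True that by blast
      ultimately show False using C'(4) that unfolding linked_def by blast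
    qed
    \<comment> \<open>Passing from \<open>P\<close> to \<open>P \<union> X\<close> removed only
      vertices of \<open>C\<close>, none of which is adjacent to \<open>D\<close>.\<close>
    have "\<not> linked ?E D (verts G - P - D)"
      using D'(3) noC X(2) unfolding linked_def by blast
    then have "component ?E (verts G - P) D" using D' unfolding component_def by blast
    then obtain R2 U2 where R2: "attached G s P f n N D R2 U2" using att by blast
    have R2n: "nested_clique N R2" "R2 \<subseteq> {..<n}" using R2 unfolding attached_def by auto
    have "f' w \<in> R2 \<and> w \<in> U2 (f' w)" if "v \<in> D" "w \<in> P \<union> X" "adj G v w" for v w
    proof -
      have "w \<in> P" using noC that X(2) by blast
      then show ?thesis using R2 that f'P(1) unfolding attached_def by simp
    qed
    then have "attached G s (P \<union> X) f' (Suc n) ?N D R2 U2"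
      using R2 nc[OF R2n] less_SucI unfolding attached_def by fastforce
    then show ?thesis by blast
  next
    case False
    have D': "D \<subseteq> verts G - (P \<union> X)" "conn ?E D" "\<not> linked ?E D (verts G - (P \<union> X) - D)"
      using D unfolding component_def by auto
    have "D \<subseteq> C" using component_absorbs[OF C D'(2)] D'(1) False by blast
    moreover have "\<not> linked ?E D (C - X - D)" using D'(3) C'(1,2) unfolding linked_def by blast
    ultimately have "component ?E (C - X) D" using D' unfolding component_def by blast
    then obtain R0 Y where Y: "card R0 < s" "X \<subseteq> Y" "new_branch_set ?E (verts G) R U D R0 Y"
      using K unfolding splits_def by blast
    have "D \<subseteq> C - X" using \<open>D \<subseteq> C\<close> D'(1) by blast
    from attached_new_part[OF R(1) this Y(2,1,3)] show ?thesis unfolding f'_def by blast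
  qed
  moreover have "P \<subset> P \<union> X" using X C'(2) by blast
  ultimately show ?thesis by blast
qed

lemma ordered_partition_exists:
  assumes G: "simple_graph G" and T: "tree_decomposition G T W"
    and J: "J_minor_free s t G" and t: "t \<ge> 2"
  shows "\<exists>f n N. ordered_partition G (verts T) W s (t - 1) (verts G) f n N"
proof -
  have "\<exists>f n N. ordered_partition G (verts T) W s (t - 1) (verts G) f n N"
    if "ordered_partition G (verts T) W s (t - 1) P f n N"
      "\<forall>C. component (adj G) (verts G - P) C \<longrightarrow> (\<exists>R U. attached G s P f n N C R U)"
    for P f n N
    using that
  proof (induction "card (verts G - P)" arbitrary: P f n N rule: less_induct)
    case less
    show ?case
    proof (cases "P = verts G")
      case True
      then show ?thesis using less.prems by blast
    next
      case False
      obtain P' f' n' N' where P': "P \<subset> P'" "ordered_partition G (verts T) W s (t - 1) P' f' n' N'"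
        "\<forall>C. component (adj G) (verts G - P') C \<longrightarrow> (\<exists>R U. attached G s P' f' n' N' C R U)"
        using ordered_partition_extend[OF G T J t less.prems(1) _ False] less.prems(2) by auto
      have "P' \<subseteq> verts G" using P'(2) unfolding ordered_partition_def by blast
      then have "verts G - P' \<subset> verts G - P" using P'(1) by blast
      then have "card (verts G - P') < card (verts G - P)"
        using G by (intro psubset_card_mono) (auto simp: simple_graph_def)
      then show ?thesis using less.hyps P'(2,3) by blast
    qed
  qed
  \<comment> \<open>At the start nothing is placed, and every component is attached to the empty set
    of parts.\<close>
  moreover have "ordered_partition G (verts T) W s (t - 1) {} f 0 N" for f N
    unfolding ordered_partition_def by simp
  moreover have "attached G s {} f 0 N C {} U" for f N C U
    unfolding attached_def nested_clique_def clique_model_def by simp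
  ultimately show ?thesis by blast
qed

section \<open>Treewidth of a graph with a perfect elimination ordering\<close>

definition parent_tree :: "nat \<Rightarrow> (nat \<Rightarrow> nat) \<Rightarrow> nat ugraph" where
  "parent_tree n p = \<lparr>verts = {..<n}, edges = {{i, p i} | i. 0 < i \<and> i < n}\<rparr>"

lemma adj_parent_tree:
  "adj (parent_tree n p) i j \<longleftrightarrow> 0 < i \<and> i < n \<and> j = p i \<or> 0 < j \<and> j < n \<and> i = p j"
  unfolding adj_def parent_tree_def by (auto simp: doubleton_eq_iff)

text \<open>Following parents from any node of \<open>A\<close> stays in \<open>A\<close> and
  decreases, so it ends at \<open>r\<close>. The lemma serves for the whole tree and for the nodes
  whose bags contain a given vertex.\<close>

lemma parent_tree_conn:
  assumes p: "\<And>i. 0 < i \<Longrightarrow> i < n \<Longrightarrow> p i < i"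
    and A: "A \<subseteq> {..<n}" "r \<in> A" "\<And>x. x \<in> A \<Longrightarrow> x \<noteq> r \<Longrightarrow> 0 < x \<and> p x \<in> A"
  shows "conn (adj (parent_tree n p)) A"
proof (rule conn_star[OF A(2)])
  fix x assume "x \<in> A"
  then show "\<exists>Z\<subseteq>A. conn (adj (parent_tree n p)) Z \<and> r \<in> Z \<and> x \<in> Z"
  proof (induction x rule: less_induct)
    case (less x)
    show ?case
    proof (cases "x = r")
      case True
      then show ?thesis using A(2) by (intro exI[of _ "{r}"]) (simp add: conn_singleton)
    next
      case False
      have x: "0 < x" "p x \<in> A" "x < n" using A(1,3) less.prems False by auto
      then obtain Z where Z: "Z \<subseteq> A" "conn (adj (parent_tree n p)) Z" "r \<in> Z" "p x \<in> Z"
        using less.IH[of "p x"] p by blast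
      have "adj (parent_tree n p) (p x) x" using x unfolding adj_parent_tree by blast
      from conn_insert[OF symp_adj Z(2,4) this] show ?thesis
        using Z less.prems by (intro exI[of _ "insert x Z"]) auto
    qed
  qed
qed

lemma is_cycle_adj_mod:
  assumes "is_cycle G vs" "i < length vs"
  shows "adj G (vs ! i) (vs ! (Suc i mod length vs))"
proof (cases "Suc i < length vs")
  case True
  then show ?thesis using assms(1) by (simp add: is_cycle_def)
next
  case False
  then have i: "i = length vs - 1" "vs \<noteq> []" "Suc i = length vs" using assms(2) by auto
  then have "vs ! i = last vs" "vs ! (Suc i mod length vs) = hd vs"
    by (simp_all add: last_conv_nth hd_conv_nth)
  then show ?thesis using assms(1) by (simp add: is_cycle_def)
qed

text \<open>The largest node of a cycle would have its parent on both sides.\<close>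

lemma is_tree_parent_tree:
  assumes n: "n \<ge> 1" and p: "\<And>i. 0 < i \<Longrightarrow> i < n \<Longrightarrow> p i < i"
  shows "is_tree (parent_tree n p)"
proof -
  let ?T = "parent_tree n p"
  have s: "simple_graph ?T"
    unfolding simple_graph_def
  proof (intro conjI ballI)
    fix e assume "e \<in> edges ?T"
    then obtain i where i: "e = {i, p i}" "0 < i" "i < n" by (auto simp: parent_tree_def)
    then show "e \<subseteq> verts ?T" "card e = 2" using p[OF i(2,3)] by (auto simp: parent_tree_def)
  qed (simp add: parent_tree_def)
  have "conn (adj ?T) (verts ?T)"
    by (rule parent_tree_conn[of n p _ 0]) (use n p less_trans in \<open>auto simp: parent_tree_def\<close>)
  then have "connected_graph ?T" using connected_graph_iff[OF s] by blast
  moreover have "\<not> is_cycle ?T vs" for vs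
  proof
    assume c: "is_cycle ?T vs"
    let ?l = "length vs"
    have l: "?l \<ge> 3" "distinct vs" using c by (auto simp: is_cycle_def)
    have "Max (set vs) \<in> set vs" using l by (intro Max_in) auto
    then obtain i where i: "i < ?l" "vs ! i = Max (set vs)" by (metis in_set_conv_nth)
    \<comment> \<open>Parents are smaller, so a neighbour of the largest node that lies on the cycle
      must be its parent.\<close>
    have nbr: "vs ! k = p (vs ! i)" if "k < ?l" "adj ?T (vs ! i) (vs ! k)" for k
    proof -
      have "vs ! k \<le> vs ! i" unfolding i(2) using that(1) by (intro Max_ge) auto
      then show ?thesis
        using that(2) p[of "vs ! k"] unfolding adj_parent_tree by linarith
    qed
    define j where "j = (if i = 0 then ?l - 1 else i - 1)"
    have l0: "0 < ?l" using l(1) by linarith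
    then have j: "j < ?l" "Suc j mod ?l = i" "Suc i mod ?l < ?l"
      using i(1) unfolding j_def by auto
    have "vs ! (Suc i mod ?l) = p (vs ! i)"
      using nbr[OF j(3) is_cycle_adj_mod[OF c i(1)]] .
    moreover have "vs ! j = p (vs ! i)"
      using nbr[OF j(1) sympD[OF symp_adj is_cycle_adj_mod[OF c j(1), unfolded j(2)]]] .
    \<comment> \<open>Predecessor and successor on the cycle are both the parent, which is
      impossible for at least 3 distinct nodes.\<close>
    ultimately have "Suc i mod ?l = j" using l(2) j by (metis nth_eq_iff_index_eq)
    moreover have "Suc i mod ?l = (if Suc i = ?l then 0 else Suc i)"
      "Suc j mod ?l = (if Suc j = ?l then 0 else Suc j)" using i(1) j(1) by auto
    ultimately show False using j(2) l(1) by (auto split: if_splits)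
  qed
  ultimately show ?thesis using s unfolding is_tree_def by blast
qed

definition ordered_graph :: "nat \<Rightarrow> (nat \<Rightarrow> nat set) \<Rightarrow> nat ugraph" where
  "ordered_graph n N = \<lparr>verts = {..<n}, edges = {{i, j} | i j. j < n \<and> i \<in> N j}\<rparr>"

lemma simple_ordered_graph:
  assumes "\<And>j. j < n \<Longrightarrow> N j \<subseteq> {..<j}"
  shows "simple_graph (ordered_graph n N)"
  unfolding simple_graph_def
proof (intro conjI ballI)
  fix e assume "e \<in> edges (ordered_graph n N)"
  then obtain i j where "e = {i, j}" "j < n" "i \<in> N j" by (auto simp: ordered_graph_def)
  moreover from this have "i < j" using assms by auto
  ultimately show "e \<subseteq> verts (ordered_graph n N)" "card e = 2" by (auto simp: ordered_graph_def)
qed (simp add: ordered_graph_def)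

text \<open>The bags are the sets \<open>{j} \<union> N j\<close>, and the node \<open>j\<close> is hung below \<open>Max (N j)\<close>.\<close>

lemma treewidth_ordered_graph:
  assumes n: "n \<ge> 1"
    and N: "\<And>j. j < n \<Longrightarrow> N j \<subseteq> {..<j} \<and> card (N j) \<le> s \<and> nested_clique N (N j)"
  shows "treewidth (ordered_graph n N) \<le> int s"
proof -
  let ?H = "ordered_graph n N"
  \<comment> \<open>A node without earlier neighbours is hung below the root 0, so the tree is
    connected even if the graph is not.\<close>
  define p where "p j = (if N j = {} then 0 else Max (N j))" for j
  define W where "W j = insert j (N j)" for j
  have fin: "finite (N j)" if "j < n" for j using N[OF that] finite_subset by blast
  have Max_N: "Max (N j) \<in> N j" if "j < n" "N j \<noteq> {}" for j using Max_in[OF fin] that by blast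
  have p: "p j < j" if "0 < j" "j < n" for j
    using Max_N[OF that(2)] N[OF that(2)] that unfolding p_def by auto
  let ?T = "parent_tree n p"
  have "tree_decomposition ?H ?T W"
    unfolding tree_decomposition_def
  proof (intro conjI ballI)
    show "is_tree ?T" using is_tree_parent_tree[OF n] p by blast
  next
    fix x assume "x \<in> verts ?T"
    then have "x < n" by (simp add: parent_tree_def)
    then show "W x \<subseteq> verts ?H" using N[of x] by (auto simp: W_def ordered_graph_def)
  next
    fix e assume "e \<in> edges ?H"
    then obtain i j where "e = {i, j}" "j < n" "i \<in> N j" by (auto simp: ordered_graph_def)
    then show "\<exists>x\<in>verts ?T. e \<subseteq> W x" by (intro bexI[of _ j]) (auto simp: W_def parent_tree_def)
  next
    fix v assume "v \<in> verts ?H"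
    then have v: "v < n" by (simp add: ordered_graph_def)
    have "conn (adj ?T) {x \<in> verts ?T. v \<in> W x}"
    proof (rule parent_tree_conn[of n p _ v])
      fix x assume "x \<in> {x \<in> verts ?T. v \<in> W x}" "x \<noteq> v"
      then have x: "x < n" "v \<in> N x" by (auto simp: parent_tree_def W_def)
      then have "v < x" using N[OF x(1)] by auto
      have px: "p x \<in> N x" "p x = Max (N x)" using x Max_N[OF x(1)] unfolding p_def by auto
      then have "p x < n" using N[OF x(1)] x(1) by auto
      \<comment> \<open>Both \<open>v\<close> and \<open>p x\<close> lie in the clique
        \<open>N x\<close>, and \<open>p x\<close> is its maximum; hence \<open>v\<close> is
        \<open>p x\<close> or one of its earlier neighbours, and it stays in the bag of the
        parent.\<close>
      have "v \<le> p x" using px(2) x fin by simp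
      moreover have "v \<in> N (p x)" if "v < p x"
        using N[OF x(1)] x(2) px(1) that unfolding nested_clique_def by blast
      ultimately show "0 < x \<and> p x \<in> {x \<in> verts ?T. v \<in> W x}"
        using \<open>v < x\<close> \<open>p x < n\<close> by (cases "v = p x") (auto simp: parent_tree_def W_def)
    qed (use p v in \<open>auto simp: parent_tree_def W_def\<close>)
    then show "connected_graph (induced ?T {x \<in> verts ?T. v \<in> W x})"
      by (subst connected_induced_iff) auto
  qed
  moreover have "card (W x) \<le> Suc s" if "x \<in> verts ?T" for x
    using N[of x] fin[of x] that by (simp add: W_def parent_tree_def card_insert_if)
  ultimately have "(LEAST k. \<exists>T W. tree_decomposition ?H T W \<and> (\<forall>x\<in>verts T. card (W x) \<le> k)) \<le> Suc s"
    by (intro Least_le) blast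
  then show ?thesis unfolding treewidth_def by simp
qed

text \<open>An empty part without earlier neighbours gives the decomposition tree a node even when
  there are no parts.\<close>

lemma ordered_partition_pad:
  assumes "ordered_partition G D W s q P f n N"
  shows "ordered_partition G D W s q P f (Suc n) (N(n := {}))"
proof -
  have lt: "f v < n" if "v \<in> P" for v using assms that unfolding ordered_partition_def by auto
  have N: "N j \<subseteq> {..<j} \<and> card (N j) \<le> s \<and> nested_clique N (N j)" if "j < n" for j
    using assms that unfolding ordered_partition_def by blast
  have "nested_clique (N(n := {})) (N j)" if "j < n" for j
    using N[OF that] that unfolding nested_clique_def by fastforce
  moreover have "\<exists>Q\<subseteq>D. finite Q \<and> card Q \<le> q \<and> {v\<in>P. f v = j} \<subseteq> \<Union>(W ` Q)" if "j < Suc n" for j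
  proof (cases "j = n")
    case True
    then have "{v\<in>P. f v = j} = {}" using lt by fastforce
    then show ?thesis by (intro exI[of _ "{}"]) auto
  next
    case False
    then show ?thesis using assms that unfolding ordered_partition_def by simp
  qed
  moreover have "(f u = f v \<or> f u \<in> (N(n := {})) (f v) \<or> f v \<in> (N(n := {})) (f u))"
    if "u \<in> P" "v \<in> P" "adj G u v" for u v
    using assms that lt[of u] lt[of v] unfolding ordered_partition_def by auto
  moreover have "f ` P \<subseteq> {..<Suc n}" using lt by (auto simp: less_Suc_eq)
  ultimately show ?thesis
    using assms N unfolding ordered_partition_def by (auto simp: less_Suc_eq nested_clique_def)
qed

section \<open>Embedding into the strong product\<close>

lemma strong_product_adjI:
  assumes "v \<in> verts A" "w \<in> verts A" "x \<in> verts B" "y \<in> verts B" "(v, x) \<noteq> (w, y)"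
    and "v = w \<or> adj A v w" "x = y \<or> adj B x y"
  shows "adj (A \<boxtimes> B) (v, x) (w, y)"
proof -
  have "v = w \<and> adj B x y \<or> x = y \<and> adj A v w \<or> adj A v w \<and> adj B x y"
    using assms(5-7) by auto
  then have "{(v, x), (w, y)} \<in> edges (A \<boxtimes> B)"
    using assms(1-5) unfolding strong_product_def
    by (simp, intro exI[of _ v] exI[of _ x] exI[of _ w] exI[of _ y]) simp
  then show ?thesis by (simp add: adj_def)
qed

lemma isomorphic_image:
  assumes G: "simple_graph G" and \<phi>: "inj_on \<phi> (verts G)"
    and verts: "\<And>v. v \<in> verts G \<Longrightarrow> \<phi> v \<in> verts A"
    and edges: "\<And>u v. adj G u v \<Longrightarrow> adj A (\<phi> u) (\<phi> v)"
  shows "\<exists>S. subgraph S A \<and> isomorphic G S"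
proof -
  \<comment> \<open>Only the images of edges of \<open>G\<close> are taken: \<open>A\<close> may
    have further edges between image vertices, so an induced subgraph need not be isomorphic to
    \<open>G\<close>.\<close>
  define S where "S = \<lparr>verts = \<phi> ` verts G, edges = (\<lambda>e. \<phi> ` e) ` edges G\<rparr>"
  have e: "e \<subseteq> verts G \<and> card e = 2" if "e \<in> edges G" for e
    using G that unfolding simple_graph_def by blast
  have "simple_graph S"
    unfolding simple_graph_def
  proof (intro conjI ballI)
    show "finite (verts S)" using G by (simp add: S_def simple_graph_def)
    fix e' assume "e' \<in> edges S"
    then obtain e where e': "e \<in> edges G" "e' = \<phi> ` e" by (auto simp: S_def)
    then show "e' \<subseteq> verts S" using e by (auto simp: S_def)
    show "card e' = 2" using e' e[of e] card_image[OF inj_on_subset[OF \<phi>]] by metis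
  qed
  moreover have "edges S \<subseteq> edges A"
  proof
    fix e' assume "e' \<in> edges S"
    then obtain e where e': "e \<in> edges G" "e' = \<phi> ` e" by (auto simp: S_def)
    obtain u v where "e = {u, v}" using e[OF e'(1)] by (auto simp: card_2_iff)
    then show "e' \<in> edges A" using edges[of u v] e' by (simp add: adj_def)
  qed
  moreover have "isomorphic G S"
    unfolding isomorphic_def
  proof (intro exI[of _ \<phi>] conjI ballI)
    show "bij_betw \<phi> (verts G) (verts S)" using \<phi> by (simp add: bij_betw_def S_def)
    fix u v assume uv: "u \<in> verts G" "v \<in> verts G"
    have "{u, v} = e" if "\<phi> ` {u, v} = \<phi> ` e" "e \<in> edges G" for e
      using inj_on_image_eq_iff[OF \<phi>, of "{u, v}" e] e[OF that(2)] that(1) uv by auto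
    then have "\<phi> ` {u, v} \<in> (\<lambda>e. \<phi> ` e) ` edges G \<longleftrightarrow> {u, v} \<in> edges G" by blast
    then show "adj G u v \<longleftrightarrow> adj S (\<phi> u) (\<phi> v)" by (simp add: adj_def S_def)
  qed
  moreover have "verts S \<subseteq> verts A" using verts by (auto simp: S_def)
  ultimately show ?thesis unfolding subgraph_def by blast
qed

theorem theorem16:
  fixes G :: "'a ugraph" and s t m :: nat
  assumes "s \<ge> 2" and "t \<ge> 2"
    and "simple_graph G"
    and "J_minor_free s t G"
    and "m = (t - 1) * layered_treewidth G"
  shows "\<exists>(H :: nat ugraph) n S.
           simple_graph H \<and> treewidth H \<le> int s \<and> n \<ge> 1 \<and>
           subgraph S (H \<boxtimes> path_graph n \<boxtimes> complete_graph m) \<and> isomorphic G S"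
proof -
  obtain L T W where L: "layering G L" and T: "tree_decomposition G T W"
    and LW: "\<And>i x. x \<in> verts T \<Longrightarrow> card (L i \<inter> W x) \<le> layered_treewidth G"
    using layered_treewidth_attained[OF assms(3)] by blast
  obtain f k N where "ordered_partition G (verts T) W s (t - 1) (verts G) f k N"
    using ordered_partition_exists[OF assms(3) T assms(4,2)] by blast
  then obtain n N where n: "n \<ge> 1" and part: "ordered_partition G (verts T) W s (t - 1) (verts G) f n N"
    \<comment> \<open>the graph \<open>H\<close> must not be empty, even if \<open>G\<close> is\<close>
    using ordered_partition_pad by (metis One_nat_def Suc_le_mono zero_le)
  have finG: "finite (verts G)" using assms(3) by (simp add: simple_graph_def)
  have f: "f v < n" if "v \<in> verts G" for v using part that unfolding ordered_partition_def by auto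
  have N: "N j \<subseteq> {..<j} \<and> card (N j) \<le> s \<and> nested_clique N (N j)" if "j < n" for j
    using part that unfolding ordered_partition_def by blast
  have fadj: "f u = f v \<or> f u \<in> N (f v) \<or> f v \<in> N (f u)" if "adj G u v" for u v
    using part that adj_verts[OF assms(3) that] unfolding ordered_partition_def by blast
  have "\<forall>v\<in>verts G. \<exists>i. v \<in> L i" using L unfolding layering_def by blast
  then obtain l where l: "\<And>v. v \<in> verts G \<Longrightarrow> v \<in> L (l v)" by metis
  \<comment> \<open>A bound on the occupied layers makes the path finite; the path on
    \<open>Suc M\<close> vertices is nonempty even if \<open>G\<close> is empty.\<close>
  obtain M where M: "\<And>v. v \<in> verts G \<Longrightarrow> l v < M"
    using finite_nat_set_iff_bounded[of "l ` verts G"] finG by auto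
  define X where "X j i = {v \<in> verts G. f v = j \<and> l v = i}" for j i
  have card_X: "card (X j i) \<le> m" if "j < n" for j i
  proof -
    have W: "W x \<subseteq> verts G" if "x \<in> verts T" for x
      using T that unfolding tree_decomposition_def by blast
    have "\<exists>Q\<subseteq>verts T. finite Q \<and> card Q \<le> t - 1 \<and> {v \<in> verts G. f v = j} \<subseteq> \<Union>(W ` Q)"
      using part that unfolding ordered_partition_def by simp
    then obtain Q where Q: "Q \<subseteq> verts T" "finite Q" "card Q \<le> t - 1"
      "{v \<in> verts G. f v = j} \<subseteq> \<Union>(W ` Q)" by (elim exE conjE)
    \<comment> \<open>Part \<open>j\<close> is covered by at most \<open>t - 1\<close> bags, each
      with at most \<open>ltw(G)\<close> vertices in layer \<open>i\<close>.\<close>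
    have "X j i \<subseteq> (\<Union>x\<in>Q. L i \<inter> W x)" using Q(4) l unfolding X_def by blast
    moreover have "finite (\<Union>x\<in>Q. L i \<inter> W x)"
      using Q(1,2) W finG by (meson finite_Int finite_UN_I finite_subset subsetD)
    ultimately have "card (X j i) \<le> card (\<Union>x\<in>Q. L i \<inter> W x)" by (rule card_mono[rotated])
    also have "\<dots> \<le> (\<Sum>x\<in>Q. card (L i \<inter> W x))" using Q(2) by (rule card_UN_le)
    also have "\<dots> \<le> card Q * layered_treewidth G"
      using sum_bounded_above[of Q "\<lambda>x. card (L i \<inter> W x)" "layered_treewidth G"] LW Q(1) by auto
    also have "\<dots> \<le> m" using Q(3) assms(5) by simp
    finally show ?thesis .
  qed
  \<comment> \<open>The vertices sharing a part and a layer are numbered; these numbers are the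
    coordinates in \<open>K_m\<close> and make the embedding injective.\<close>
  have "\<forall>j i. \<exists>h. bij_betw h (X j i) {0..<card (X j i)}"
    using finG by (auto intro!: ex_bij_betw_finite_nat simp: X_def)
  then obtain h where h: "\<And>j i. bij_betw (h j i) (X j i) {0..<card (X j i)}" by metis
  define c where "c v = h (f v) (l v) v" for v
  have vX: "v \<in> X (f v) (l v)" if "v \<in> verts G" for v using that by (simp add: X_def)
  have c: "c v < m" if "v \<in> verts G" for v
    using bij_betwE[OF h] vX[OF that] card_X[OF f[OF that]] unfolding c_def
    by (metis atLeastLessThan_iff order_less_le_trans)
  define \<phi> where "\<phi> v = ((f v, l v), c v)" for v
  let ?H = "ordered_graph n N"
  let ?A = "?H \<boxtimes> path_graph (Suc M) \<boxtimes> complete_graph m"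
  have inj: "inj_on \<phi> (verts G)"
  proof (rule inj_onI)
    fix u v assume uv: "u \<in> verts G" "v \<in> verts G" "\<phi> u = \<phi> v"
    then have "f u = f v" "l u = l v" "c u = c v" by (auto simp: \<phi>_def)
    then show "u = v" using h[of "f v" "l v"] vX[OF uv(1)] vX[OF uv(2)]
      unfolding c_def bij_betw_def by (metis inj_onD)
  qed
  have verts: "f v \<in> verts ?H" "l v \<in> verts (path_graph (Suc M))" "c v \<in> verts (complete_graph m)"
    if "v \<in> verts G" for v
    using f[OF that] M[OF that] c[OF that]
    by (simp_all add: ordered_graph_def path_graph_def complete_graph_def)
  have "adj ?A (\<phi> u) (\<phi> v)" if e: "adj G u v" for u v
  proof -
    have uv: "u \<in> verts G" "v \<in> verts G" "u \<noteq> v" using adj_verts[OF assms(3) e] by auto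
    have "f u = f v \<or> adj ?H (f u) (f v)"
      using fadj[OF e] f[OF uv(1)] f[OF uv(2)] unfolding adj_def ordered_graph_def
      by (auto simp: insert_commute)
    moreover have "\<bar>int (l u) - int (l v)\<bar> \<le> 1"
      using L l[OF uv(1)] l[OF uv(2)] e unfolding layering_def by blast
    then have "l u = l v \<or> l v = Suc (l u) \<or> l u = Suc (l v)" by linarith
    then have "l u = l v \<or> adj (path_graph (Suc M)) (l u) (l v)"
      using M[OF uv(1)] M[OF uv(2)] unfolding adj_def path_graph_def by (auto simp: insert_commute)
    ultimately have "(f u, l u) = (f v, l v) \<or> adj (?H \<boxtimes> path_graph (Suc M)) (f u, l u) (f v, l v)"
      using strong_product_adjI verts[OF uv(1)] verts[OF uv(2)] by metis
    moreover have "c u = c v \<or> adj (complete_graph m) (c u) (c v)"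
      using c[OF uv(1)] c[OF uv(2)] unfolding adj_def complete_graph_def by auto
    moreover have "\<phi> u \<noteq> \<phi> v" using inj uv by (meson inj_onD)
    moreover have "(f w, l w) \<in> verts (?H \<boxtimes> path_graph (Suc M))" if "w \<in> verts G" for w
      using verts[OF that] by (simp add: strong_product_def)
    ultimately show ?thesis
      using verts[OF uv(1)] verts[OF uv(2)] uv unfolding \<phi>_def by (intro strong_product_adjI) auto
  qed
  moreover have "\<phi> v \<in> verts ?A" if "v \<in> verts G" for v
    using verts[OF that] by (simp add: \<phi>_def strong_product_def)
  ultimately obtain S where "subgraph S ?A" "isomorphic G S"
    using isomorphic_image[OF assms(3) inj, of ?A] by blast
  moreover have "simple_graph ?H" using N by (intro simple_ordered_graph) blast
  moreover have "treewidth ?H \<le> int s" using treewidth_ordered_graph[OF n N] by blast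
  ultimately show ?thesis by (intro exI[of _ ?H] exI[of _ "Suc M"] exI[of _ S]) auto
qed

end
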